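(* Let $\mathcal{X}$ be a compact subset of $\mathbb{R}^d$, $d\in\mathbb{N}$, with $\mathrm{diam}(\mathcal{X})\ge1$, let the cost $c$ satisfy the Lipschitz cost assumption and let $\mu,\nu$ satisfy the ball-mass assumption (see context). Let $\tau\in(0,1)$, $0<\varepsilon\le1$ and $N\ge3$. Then with probability at least $1-\tau$, $$\|T^{C,\varepsilon}_N-T^\varepsilon\|_{\mathrm{HS}}\ \le\ \|t^{C,\varepsilon}_N-t^\varepsilon\|_\infty\ \le\ M\,\frac{\sqrt{2d}}{\varepsilon^{1+\mathcal{D}_\mu+\mathcal{D}_\nu}}\sqrt{\frac{\log N}{N}}\sqrt{\log\left(\frac{4\sqrt2\,\mathrm{diam}(\mathcal{X})}{\tau}\right)},$$ with a constant $M>0$ depending only on $C_\mu$, $C_\nu$ and $\mathrm{Lip}(c)$.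
   Context: $\mathcal{X}\subset\mathbb{R}^d$ is equipped with the Euclidean metric, also written $d(\cdot,\cdot)$. $\mathcal{P}(\mathcal{X})$ is the set of Borel probability measures, $\mathrm{spt}$ denotes support, $B(x,r)=\{x'\in\mathcal{X}:d(x,x')<r\}$, $\|\cdot\|_{\mathrm{HS}}$ is the Hilbert--Schmidt norm, and $\|\cdot\|_\infty$ is the supremum over $\mathcal{X}\times\mathcal{X}$. Lipschitz cost assumption: $c:\mathcal{X}\times\mathcal{X}\to\mathbb{R}$ is continuous and symmetric, $c\ge0$, $c(x,x)=0$, and there is $\mathrm{Lip}(c)>0$ with $|c(x,y)-c(x',y)|\le\mathrm{Lip}(c)\,d(x,x')$ for all $x,x',y$. Ball-mass assumption: there are constants $C_\mu,\mathcal{D}_\mu,\delta_\mu>0$ with $\mu(B(x,\delta))\ge C_\mu\delta^{\mathcal{D}_\mu}$ for all $\delta\in(0,\delta_\mu]$, $x\in\mathrm{spt}(\mu)$; moreover $C_\mu\le1$ and $\mathcal{D}_\mu\le d$ (the dimension). Analogous constants $C_\nu,\mathcal{D}_\nu,\delta_\nu$ exist for $\nu$. Entropic transport kernel: for $\rho,\sigma\in\mathcal{P}(\mathcal{X})$ and $\varepsilon>0$, $k^\varepsilon_{\rho\sigma}(x,y)=\exp([\alpha(x)+\beta(y)-c(x,y)]/\varepsilon)$ on $\mathcal{X}\times\mathcal{X}$, where $\alpha,\beta\in C(\mathcal{X})$ maximize $\int\alpha\,d\rho+\int\beta\,d\sigma-\varepsilon\int[\exp((\alpha(x)+\beta(y)-c(x,y))/\varepsilon)-1]\,d(\rho\otimes\sigma)(x,y)$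 and satisfy, for all $x,y\in\mathcal{X}$, $\alpha(x)=-\varepsilon\log\int\exp([\beta(y')-c(x,y')]/\varepsilon)\,d\sigma(y')$ and $\beta(y)=-\varepsilon\log\int\exp([\alpha(x')-c(x',y)]/\varepsilon)\,d\rho(x')$. Such pairs exist and $\alpha(x)+\beta(y)$ does not depend on the choice, so $k^\varepsilon_{\rho\sigma}\in C(\mathcal{X}\times\mathcal{X})$ is well defined. Data: $\mu,\nu\in\mathcal{P}(\mathcal{X})$, $\pi$ is a probability measure on $\mathcal{X}\times\mathcal{X}$ with first marginal $\mu$ and second marginal $\nu$; $(x_i,y_i)_{i=1}^N$ are i.i.d. with law $\pi$; $\pi_N=\frac1N\sum_i\delta_{(x_i,y_i)}$. Operators: $t^\varepsilon(x,y)=\int k^\varepsilon_{\mu\mu}(x,x')\,k^\varepsilon_{\nu\nu}(y',y)\,d\pi(x',y')$ and $T^\varepsilon:L^2(\mu)\to L^2(\nu)$, $u\mapsto\int u(x)t^\varepsilon(x,\cdot)\,d\mu(x)$ (the entropic regularization of the transfer operator induced by $\pi$). $t^{C,\varepsilon}_N(x,y)=\int k^\varepsilon_{\mu\mu}(x,x')\,k^\varepsilon_{\nu\nu}(y',y)\,d\pi_N(x',y')$ and $T^{C,\varepsilon}_N:L^2(\mu)\to L^2(\nu)$, $u\mapsto\int u(x)t^{C,\varepsilon}_N(x,\cdot)\,d\mu(x)$.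
   Formalization: The bound carries the extra factor max(1, ε/δ_μ)^{D_μ}·max(1, ε/δ_ν)^{D_ν}, equal to 1 when ε ≤ δ_μ and ε ≤ δ_ν; without it the claim fails for M depending only on C_μ, C_ν, Lip(c) (uniform measure on n points spaced by 3, δ = 1/n, ε = 1). *)

theory Defs
  imports "HOL-Probability.Probability"
begin

text \<open>
  The space of dimension \<open>d\<close> is the library's \<open>Euclidean_space d\<close>: sequences \<open>nat \<Rightarrow> real\<close> vanishing
  from index \<open>d\<close> on, with the product topology. All dimensions thus live in one type, so that a
  constant can be required not to depend on \<open>d\<close>. The product topology induces the usual topology
  there, hence \<open>compact\<close>, \<open>continuous_on\<close> and \<open>borel\<close> have their usual meaning. The \<open>dist\<close> of the
  type \<open>nat \<Rightarrow> real\<close> is a different metric and is not used.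
\<close>

type_synonym point = "nat \<Rightarrow> real"

definition edist :: "nat \<Rightarrow> point \<Rightarrow> point \<Rightarrow> real" where
  "edist d x y = sqrt (\<Sum>i<d. (x i - y i)\<^sup>2)"

definition ediam :: "nat \<Rightarrow> point set \<Rightarrow> real" where
  "ediam d X = (if X = {} then 0 else (SUP (x, y)\<in>X \<times> X. edist d x y))"

definition eball :: "nat \<Rightarrow> point set \<Rightarrow> point \<Rightarrow> real \<Rightarrow> point set" where
  "eball d X x r = {x' \<in> X. edist d x x' < r}"

abbreviation borel_on :: "point set \<Rightarrow> point measure" where
  "borel_on X \<equiv> restrict_space borel X"

definition borel_prob :: "point set \<Rightarrow> point measure \<Rightarrow> bool" where
  "borel_prob X \<mu> \<longleftrightarrow> prob_space \<mu> \<and> sets \<mu> = sets (borel_on X)"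

definition coupling ::
  "point set \<Rightarrow> point measure \<Rightarrow> point measure \<Rightarrow> (point \<times> point) measure \<Rightarrow> bool" where
  "coupling X \<mu> \<nu> \<pi> \<longleftrightarrow> prob_space \<pi> \<and> sets \<pi> = sets (borel_on X \<Otimes>\<^sub>M borel_on X) \<and>
     distr \<pi> (borel_on X) fst = \<mu> \<and> distr \<pi> (borel_on X) snd = \<nu>"

definition spt :: "nat \<Rightarrow> point set \<Rightarrow> point measure \<Rightarrow> point set" where
  "spt d X \<mu> = {x \<in> X. \<forall>r>0. measure \<mu> (eball d X x r) > 0}"

definition lipschitz_cost ::
  "nat \<Rightarrow> point set \<Rightarrow> (point \<Rightarrow> point \<Rightarrow> real) \<Rightarrow> real \<Rightarrow> bool" where
  "lipschitz_cost d X c L \<longleftrightarrow>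
     continuous_on (X \<times> X) (\<lambda>(x, y). c x y) \<and>
     (\<forall>x\<in>X. \<forall>y\<in>X. c x y = c y x) \<and>
     (\<forall>x\<in>X. \<forall>y\<in>X. 0 \<le> c x y) \<and>
     (\<forall>x\<in>X. c x x = 0) \<and>
     0 < L \<and>
     (\<forall>x\<in>X. \<forall>x'\<in>X. \<forall>y\<in>X. \<bar>c x y - c x' y\<bar> \<le> L * edist d x x')"

definition ball_mass ::
  "nat \<Rightarrow> point set \<Rightarrow> point measure \<Rightarrow> real \<Rightarrow> real \<Rightarrow> real \<Rightarrow> bool" where
  "ball_mass d X \<mu> C D \<delta>0 \<longleftrightarrow>
     0 < C \<and> C \<le> 1 \<and> 0 < D \<and> D \<le> real d \<and> 0 < \<delta>0 \<and>
     (\<forall>\<delta>. 0 < \<delta> \<and> \<delta> \<le> \<delta>0 \<longrightarrow>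
        (\<forall>x \<in> spt d X \<mu>. measure \<mu> (eball d X x \<delta>) \<ge> C * \<delta> powr D))"

text \<open>
  Ball mass is only assumed for radii up to \<open>\<delta>0\<close>. At a scale \<open>\<epsilon>\<close> beyond \<open>\<delta>0\<close> it only gives
  \<open>\<mu>(B(x,\<epsilon>)) \<ge> C * \<delta>0 powr D\<close>, which falls short of \<open>C * \<epsilon> powr D\<close> by the following factor. For
  \<open>\<epsilon> \<le> \<delta>0\<close> the factor is 1; for \<open>\<epsilon> \<le> 1\<close> it is at most \<open>max 1 (1 / \<delta>0) powr D\<close>. It cannot be
  absorbed into a constant that depends on \<open>C\<close> and the Lipschitz constant only: the uniform
  measure on \<open>n\<close> points of the line spaced by 3 satisfies \<open>ball_mass\<close> with \<open>C = D = 1\<close> and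
  \<open>\<delta>0 = 1 / n\<close>, and its kernel for the cost \<open>\<bar>x - y\<bar>\<close> and \<open>\<epsilon> = 1\<close> exceeds \<open>n / 2\<close> on the diagonal.
\<close>

definition scale_factor :: "real \<Rightarrow> real \<Rightarrow> real \<Rightarrow> real" where
  "scale_factor D \<delta>0 \<epsilon> = max 1 (\<epsilon> / \<delta>0) powr D"

definition eot_dual ::
  "(point \<Rightarrow> point \<Rightarrow> real) \<Rightarrow> real \<Rightarrow> point measure \<Rightarrow> point measure \<Rightarrow>
     (point \<Rightarrow> real) \<Rightarrow> (point \<Rightarrow> real) \<Rightarrow> real" where
  "eot_dual c \<epsilon> \<rho> \<sigma> \<alpha> \<beta> =
     (\<integral>x. \<alpha> x \<partial>\<rho>) + (\<integral>y. \<beta> y \<partial>\<sigma>) -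
     \<epsilon> * (\<integral>(x, y). exp ((\<alpha> x + \<beta> y - c x y) / \<epsilon>) - 1 \<partial>(\<rho> \<Otimes>\<^sub>M \<sigma>))"

definition eot_potentials ::
  "point set \<Rightarrow> (point \<Rightarrow> point \<Rightarrow> real) \<Rightarrow> real \<Rightarrow> point measure \<Rightarrow> point measure \<Rightarrow>
     (point \<Rightarrow> real) \<Rightarrow> (point \<Rightarrow> real) \<Rightarrow> bool" where
  "eot_potentials X c \<epsilon> \<rho> \<sigma> \<alpha> \<beta> \<longleftrightarrow>
     continuous_on X \<alpha> \<and> continuous_on X \<beta> \<and>
     (\<forall>\<alpha>' \<beta>'. continuous_on X \<alpha>' \<and> continuous_on X \<beta>' \<longrightarrow>
        eot_dual c \<epsilon> \<rho> \<sigma> \<alpha>' \<beta>' \<le> eot_dual c \<epsilon> \<rho> \<sigma> \<alpha> \<beta>) \<and>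
     (\<forall>x\<in>X. \<alpha> x = - \<epsilon> * ln (\<integral>y'. exp ((\<beta> y' - c x y') / \<epsilon>) \<partial>\<sigma>)) \<and>
     (\<forall>y\<in>X. \<beta> y = - \<epsilon> * ln (\<integral>x'. exp ((\<alpha> x' - c x' y) / \<epsilon>) \<partial>\<rho>))"

text \<open>
  Potentials exist and \<open>\<alpha> x + \<beta> y\<close> does not depend on their choice, so that for Borel probability
  measures this determines \<open>k\<close> on \<open>X \<times> X\<close>.
\<close>

definition is_eot_kernel ::
  "point set \<Rightarrow> (point \<Rightarrow> point \<Rightarrow> real) \<Rightarrow> real \<Rightarrow> point measure \<Rightarrow> point measure \<Rightarrow>
     (point \<Rightarrow> point \<Rightarrow> real) \<Rightarrow> bool" where
  "is_eot_kernel X c \<epsilon> \<rho> \<sigma> k \<longleftrightarrow>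
     (\<exists>\<alpha> \<beta>. eot_potentials X c \<epsilon> \<rho> \<sigma> \<alpha> \<beta> \<and>
        (\<forall>x\<in>X. \<forall>y\<in>X. k x y = exp ((\<alpha> x + \<beta> y - c x y) / \<epsilon>)))"

definition transfer_kernel ::
  "(point \<Rightarrow> point \<Rightarrow> real) \<Rightarrow> (point \<Rightarrow> point \<Rightarrow> real) \<Rightarrow> (point \<times> point) measure \<Rightarrow>
     point \<Rightarrow> point \<Rightarrow> real" where
  "transfer_kernel k\<^sub>\<mu> k\<^sub>\<nu> \<pi> x y = (\<integral>(x', y'). k\<^sub>\<mu> x x' * k\<^sub>\<nu> y' y \<partial>\<pi>)"

definition empirical ::
  "point set \<Rightarrow> nat \<Rightarrow> (nat \<Rightarrow> point \<times> point) \<Rightarrow> (point \<times> point) measure" where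
  "empirical X N z = distr (uniform_count_measure {..<N}) (borel_on X \<Otimes>\<^sub>M borel_on X) z"

text \<open>Operators between \<open>L\<^sup>2\<close> spaces act on real-valued representatives.\<close>

type_synonym operator = "(point \<Rightarrow> real) \<Rightarrow> point \<Rightarrow> real"

definition kernel_op :: "point measure \<Rightarrow> (point \<Rightarrow> point \<Rightarrow> real) \<Rightarrow> operator" where
  "kernel_op \<mu> t u = (\<lambda>y. \<integral>x. u x * t x y \<partial>\<mu>)"

definition op_diff :: "operator \<Rightarrow> operator \<Rightarrow> operator" where
  "op_diff A B u = (\<lambda>y. A u y - B u y)"

definition L2_funs :: "point measure \<Rightarrow> (point \<Rightarrow> real) set" where
  "L2_funs \<mu> = {u \<in> borel_measurable \<mu>. integrable \<mu> (\<lambda>x. (u x)\<^sup>2)}"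

text \<open>
  Distinct members of an orthonormal set are never equal almost everywhere, so a set of
  representatives is as good as a set of classes.
\<close>

definition orthonormal_basis :: "point measure \<Rightarrow> (point \<Rightarrow> real) set \<Rightarrow> bool" where
  "orthonormal_basis \<mu> E \<longleftrightarrow>
     E \<subseteq> L2_funs \<mu> \<and>
     (\<forall>e\<in>E. \<forall>f\<in>E. (\<integral>x. e x * f x \<partial>\<mu>) = (if e = f then 1 else 0)) \<and>
     (\<forall>u \<in> L2_funs \<mu>. (\<forall>e\<in>E. (\<integral>x. u x * e x \<partial>\<mu>) = 0) \<longrightarrow> (AE x in \<mu>. u x = 0))"

text \<open>
  The Hilbert--Schmidt norm; the value is the same for every orthonormal basis of \<open>L\<^sup>2(\<mu>)\<close>, and it
  is \<open>\<infinity>\<close> for an operator that is not Hilbert--Schmidt.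
\<close>

definition hs_norm :: "point measure \<Rightarrow> point measure \<Rightarrow> operator \<Rightarrow> ennreal" where
  "hs_norm \<mu> \<nu> A =
     (let s = (\<Sum>\<^sub>\<infinity>e\<in>(SOME E. orthonormal_basis \<mu> E). \<integral>\<^sup>+y. ennreal ((A e y)\<^sup>2) \<partial>\<nu>)
      in if s = \<infinity> then \<infinity> else ennreal (sqrt (enn2real s)))"

definition sup_norm :: "point set \<Rightarrow> (point \<Rightarrow> point \<Rightarrow> real) \<Rightarrow> ennreal" where
  "sup_norm X t = (SUP (x, y)\<in>X \<times> X. ennreal \<bar>t x y\<bar>)"

end

theory Submission
  imports Defs
begin

text \<open>
  The kernel \<open>t\<^sub>N(x, y)\<close> is the empirical mean, and \<open>t(x, y)\<close> the expectation, of the function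
  \<open>k\<^sub>\<mu>(x, x') k\<^sub>\<nu>(y', y)\<close> of the sample \<open>(x', y')\<close>. The theorem is therefore a uniform law of large
  numbers for a family of functions indexed by \<open>(x, y) \<in> X \<times> X\<close>. It follows from a sup bound \<open>B\<close> and
  a Lipschitz bound for the family: Hoeffding's inequality at the points of a finite net of
  \<open>X \<times> X\<close>, a union bound, and Lipschitz interpolation between the points of the net.

  Both bounds come from the Schroedinger system. The potentials are soft-minima of the cost and so
  inherit its Lipschitz constant \<open>L\<close>; hence \<open>ln k\<close> is \<open>2L/\<epsilon>\<close>-Lipschitz in each variable. As \<open>k\<close>
  integrates to 1 in each variable and changes by a factor of at most \<open>exp (2L)\<close> on a ball of radius
  \<open>\<epsilon>\<close>, its value at a point of the support is at most \<open>exp (2L)\<close> over the mass of such a ball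
  (\<open>kernel_le_on_spt\<close>). The sample lies in the supports almost surely (\<open>AE_in_spt\<close>), while \<open>x\<close> and
  \<open>y\<close> may be arbitrary points of \<open>X\<close>: this is why the kernels are only needed with one argument in
  a support. Lipschitz continuity of \<open>ln k\<close> then turns the bound \<open>B\<close> into the Lipschitz
  constant \<open>2LB/\<epsilon>\<close>, which is where the extra power of \<open>\<epsilon>\<close> comes from.

  The net has mesh \<open>1/\<surd>N\<close>, so that interpolation costs \<open>8LB/(\<epsilon>\<surd>N)\<close>. For the constant to be free
  of the dimension, the net must have at most \<open>(const \<cdot> diam \<cdot> \<surd>N)\<^sup>d\<close> points, without a factor
  \<open>\<surd>d\<close> in the base as a cube-wise count would give. The classical argument compares volumes of
  balls; here a generating function counts the lattice points of an \<open>\<ell>\<^sup>1\<close> ball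
  (\<open>card_lattice_l1_ball_le\<close>, \<open>finite_net\<close>).

  Finally, the Hilbert--Schmidt norm of an integral operator between probability spaces is at most
  the sup norm of its kernel, by Bessel's inequality in one variable
  (\<open>hs_norm_le_of_kernel_bound\<close>). This holds for every sample, so only the second inequality
  carries a probability.
\<close>

section \<open>Dimension-free covering numbers\<close>

lemma edist_nonneg [simp]: "0 \<le> edist d x y"
  by (simp add: edist_def sum_nonneg)

lemma edist_self [simp]: "edist d x x = 0"
  by (simp add: edist_def)

lemma edist_commute: "edist d x y = edist d y x"
  by (simp add: edist_def power2_commute)

lemma edist_eq_L2_set: "edist d x y = L2_set (\<lambda>i. x i - y i) {..<d}"
  by (simp add: edist_def L2_set_def)

lemma edist_triangle: "edist d x z \<le> edist d x y + edist d y z"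
  using L2_set_triangle_ineq[of "\<lambda>i. x i - y i" "\<lambda>i. y i - z i" "{..<d}"]
  by (simp add: edist_eq_L2_set)

text \<open>
  A two-sided geometric series with ratio \<open>exp (- 1 / R) \<le> R / (1 + R)\<close>.
\<close>

lemma sum_exp_neg_abs_le:
  fixes R :: real and K :: nat
  assumes "0 < R"
  shows "(\<Sum>j\<in>{- int K..int K}. exp (- real_of_int \<bar>j\<bar> / R)) \<le> 2 * (1 + R)"
proof -
  define q where "q = exp (- 1 / R)"
  have q: "0 < q" "q < 1" using assms by (auto simp: q_def)
  have "1 + 1 / R \<le> exp (1 / R)" by (rule exp_ge_add_one_self)
  then have "q * (1 + 1 / R) \<le> q * exp (1 / R)" using q by (intro mult_left_mono) auto
  also have "q * exp (1 / R) = 1" by (simp add: q_def flip: exp_add)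
  finally have "q * (1 + 1 / R) \<le> 1" .
  then have "q * (R + 1) \<le> R" using assms by (simp add: field_simps)
  then have "1 \<le> (1 - q) * (1 + R)" by (simp add: algebra_simps)
  then have inv: "1 / (1 - q) \<le> 1 + R" using q by (simp add: field_simps)
  have pw: "exp (- real_of_int \<bar>int n\<bar> / R) = q ^ n" for n
    by (simp add: q_def flip: exp_of_nat_mult)
  have geo: "(\<Sum>n\<le>K. q ^ n) \<le> 1 / (1 - q)"
    using q sum_le_suminf[of "\<lambda>n. q ^ n" "{..K}"] suminf_geometric[of q] by (simp add: summable_geometric)
  have eq: "{- int K..int K} = int ` {..K} \<union> (\<lambda>n. - int n) ` {..K}"
  proof (intro equalityI subsetI)
    fix j assume "j \<in> {- int K..int K}"
    then show "j \<in> int ` {..K} \<union> (\<lambda>n. - int n) ` {..K}"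
      by (cases "0 \<le> j") (auto intro!: image_eqI[of _ _ "nat \<bar>j\<bar>"])
  qed auto
  have "(\<Sum>j\<in>{- int K..int K}. exp (- real_of_int \<bar>j\<bar> / R))
      \<le> (\<Sum>j\<in>int ` {..K}. exp (- real_of_int \<bar>j\<bar> / R))
       + (\<Sum>j\<in>(\<lambda>n. - int n) ` {..K}. exp (- real_of_int \<bar>j\<bar> / R))"
    unfolding eq by (subst sum_Un) (auto intro!: sum_nonneg)
  also have "(\<Sum>j\<in>int ` {..K}. exp (- real_of_int \<bar>j\<bar> / R)) = (\<Sum>n\<le>K. q ^ n)"
    by (subst sum.reindex) (auto simp: inj_on_def pw[simplified])
  also have "(\<Sum>j\<in>(\<lambda>n. - int n) ` {..K}. exp (- real_of_int \<bar>j\<bar> / R)) = (\<Sum>n\<le>K. q ^ n)"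
    by (subst sum.reindex) (auto simp: inj_on_def pw[simplified])
  finally have "(\<Sum>j\<in>{- int K..int K}. exp (- real_of_int \<bar>j\<bar> / R))
      \<le> (\<Sum>n\<le>K. q ^ n) + (\<Sum>n\<le>K. q ^ n)" .
  also have "\<dots> \<le> (1 + R) + (1 + R)"
    using geo inv by (intro add_mono) auto
  finally show ?thesis by simp
qed

text \<open>
  Each lattice point of the ball is counted with weight at least 1 by
  \<open>exp (d - (\<Sum>i<d. \<bar>g i\<bar>) / R)\<close>. This weight factorizes over the coordinates, so its sum over all
  lattice points is a \<open>d\<close>-th power. The box bound \<open>K\<close> keeps the sums finite.
\<close>

lemma card_lattice_l1_ball_le:
  fixes R :: real and K d :: nat
  assumes "0 < R"
  defines "G \<equiv> {g \<in> PiE {..<d} (\<lambda>_. {- int K..int K}). (\<Sum>i<d. real_of_int \<bar>g i\<bar>) \<le> real d * R}"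
  shows "finite G" and "real (card G) \<le> (2 * exp 1 * (1 + R)) ^ d"
proof -
  let ?P = "PiE {..<d} (\<lambda>_. {- int K..int K})"
  have finP: "finite ?P" by (intro finite_PiE) auto
  then show finG: "finite G" unfolding G_def by simp
  have "real (card G) = (\<Sum>g\<in>G. 1)" by simp
  also have "\<dots> \<le> (\<Sum>g\<in>G. exp 1 ^ d * (\<Prod>i<d. exp (- real_of_int \<bar>g i\<bar> / R)))"
  proof (rule sum_mono)
    fix g assume "g \<in> G"
    then have "(\<Sum>i<d. real_of_int \<bar>g i\<bar>) \<le> real d * R" by (simp add: G_def)
    then have "0 \<le> real d + (\<Sum>i<d. - real_of_int \<bar>g i\<bar> / R)"
      using assms by (simp add: sum_negf field_simps flip: sum_divide_distrib)
    then have "1 \<le> exp (real d + (\<Sum>i<d. - real_of_int \<bar>g i\<bar> / R))" by simp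
    also have "\<dots> = exp 1 ^ d * (\<Prod>i<d. exp (- real_of_int \<bar>g i\<bar> / R))"
      by (simp add: exp_add exp_sum flip: exp_of_nat_mult)
    finally show "1 \<le> exp 1 ^ d * (\<Prod>i<d. exp (- real_of_int \<bar>g i\<bar> / R))" .
  qed
  also have "\<dots> \<le> (\<Sum>g\<in>?P. exp 1 ^ d * (\<Prod>i<d. exp (- real_of_int \<bar>g i\<bar> / R)))"
  proof (rule sum_mono2[OF finP])
    show "G \<subseteq> ?P" by (auto simp: G_def)
    show "0 \<le> exp 1 ^ d * (\<Prod>i<d. exp (- real_of_int \<bar>g i\<bar> / R))" for g :: "nat \<Rightarrow> int"
      by (intro mult_nonneg_nonneg prod_nonneg) auto
  qed
  also have "\<dots> = exp 1 ^ d * (\<Prod>i<d. \<Sum>j\<in>{- int K..int K}. exp (- real_of_int \<bar>j\<bar> / R))"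
    by (subst prod_sum_PiE) (auto simp: sum_distrib_left)
  also have "\<dots> = exp 1 ^ d * (\<Sum>j\<in>{- int K..int K}. exp (- real_of_int \<bar>j\<bar> / R)) ^ d"
    by simp
  also have "\<dots> \<le> exp 1 ^ d * (2 * (1 + R)) ^ d"
    by (intro mult_left_mono power_mono sum_exp_neg_abs_le assms sum_nonneg) auto
  also have "\<dots> = (2 * exp 1 * (1 + R)) ^ d"
    by (simp add: power_mult_distrib mult_ac)
  finally show "real (card G) \<le> (2 * exp 1 * (1 + R)) ^ d" .
qed

text \<open>
  The points of \<open>X\<close> are sorted into cubes of side \<open>r / \<surd>d\<close>, and one point is taken from each cube
  that meets \<open>X\<close>. By Cauchy--Schwarz a Euclidean distance of \<open>\<Delta>\<close> from \<open>x0\<close> is an \<open>\<ell>\<^sup>1\<close> distance of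
  at most \<open>\<Delta> \<surd>d\<close>, which is \<open>d \<Delta> / r\<close> cube sides. The occupied cubes thus lie in an \<open>\<ell>\<^sup>1\<close> ball of
  radius proportional to \<open>d\<close>, for which the lattice count has the base \<open>2 e (2 + \<Delta> / r)\<close>, free of
  \<open>d\<close>.
\<close>

lemma finite_net:
  assumes x0: "x0 \<in> X" and diam: "\<And>x y. x \<in> X \<Longrightarrow> y \<in> X \<Longrightarrow> edist d x y \<le> \<Delta>"
    and r: "0 < r" and d: "0 < d"
  obtains Y where "finite Y" "Y \<subseteq> X" "real (card Y) \<le> (2 * exp 1 * (2 + \<Delta> / r)) ^ d"
    "\<And>x. x \<in> X \<Longrightarrow> \<exists>p\<in>Y. edist d x p \<le> r"
proof -
  have "0 \<le> \<Delta>" using diam[OF x0 x0] by simp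
  define h where "h = r / sqrt d"
  have h: "0 < h" using r d by (simp add: h_def)
  define R where "R = 1 + \<Delta> / r"
  have R: "0 < R" using r \<open>0 \<le> \<Delta>\<close> by (simp add: R_def add_pos_nonneg)
  define \<phi> where "\<phi> x = (\<lambda>i\<in>{..<d}. \<lfloor>(x i - x0 i) / h\<rfloor>)" for x :: point
  define K where "K = nat \<lceil>real d * R\<rceil>"
  define G where "G = {g \<in> PiE {..<d} (\<lambda>_. {- int K..int K}). (\<Sum>i<d. real_of_int \<bar>g i\<bar>) \<le> real d * R}"
  have \<phi>G: "\<phi> x \<in> G" if x: "x \<in> X" for x
  proof -
    have "(\<Sum>i<d. \<bar>x i - x0 i\<bar> * \<bar>1\<bar>) \<le> L2_set (\<lambda>i. x i - x0 i) {..<d} * L2_set (\<lambda>_. 1) {..<d}"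
      by (rule L2_set_mult_ineq)
    also have "\<dots> \<le> \<Delta> * sqrt d"
      using diam[OF x x0] by (auto simp: L2_set_constant edist_eq_L2_set intro: mult_right_mono)
    finally have l1: "(\<Sum>i<d. \<bar>x i - x0 i\<bar>) \<le> \<Delta> * sqrt d" by simp
    have "(\<Sum>i<d. real_of_int \<bar>\<phi> x i\<bar>) \<le> (\<Sum>i<d. \<bar>x i - x0 i\<bar> / h + 1)"
    proof (rule sum_mono)
      fix i assume i: "i \<in> {..<d}"
      \<comment> \<open>Rounding down may increase the modulus by one, hence the summand 1 in \<open>R\<close>.\<close>
      have "\<bar>real_of_int \<lfloor>(x i - x0 i) / h\<rfloor>\<bar> \<le> \<bar>(x i - x0 i) / h\<bar> + 1" by linarith
      then show "real_of_int \<bar>\<phi> x i\<bar> \<le> \<bar>x i - x0 i\<bar> / h + 1"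
        using i h by (simp add: \<phi>_def)
    qed
    also have "\<dots> = (\<Sum>i<d. \<bar>x i - x0 i\<bar>) / h + d"
      by (simp add: sum.distrib sum_divide_distrib)
    also have "\<dots> \<le> \<Delta> * sqrt d / h + d"
      using l1 h by (simp add: divide_right_mono)
    also have "\<Delta> * sqrt d / h = real d * (\<Delta> / r)"
      using r d by (simp add: h_def field_simps)
    finally have s: "(\<Sum>i<d. real_of_int \<bar>\<phi> x i\<bar>) \<le> real d * R"
      by (simp add: R_def algebra_simps)
    have "\<phi> x i \<in> {- int K..int K}" if "i < d" for i
    proof -
      have "real_of_int \<bar>\<phi> x i\<bar> \<le> (\<Sum>i<d. real_of_int \<bar>\<phi> x i\<bar>)"
        using that by (intro member_le_sum) auto
      then have "real_of_int \<bar>\<phi> x i\<bar> \<le> real d * R" using s by linarith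
      then have "\<bar>\<phi> x i\<bar> \<le> int K" unfolding K_def by linarith
      then show ?thesis by auto
    qed
    then show ?thesis using s by (auto simp: G_def \<phi>_def)
  qed
  define rep where "rep g = (SOME x. x \<in> X \<and> \<phi> x = g)" for g
  have rep: "rep (\<phi> x) \<in> X \<and> \<phi> (rep (\<phi> x)) = \<phi> x" if "x \<in> X" for x
    unfolding rep_def by (rule someI[of _ x]) (use that in auto)
  have finG: "finite G" and cardG: "real (card G) \<le> (2 * exp 1 * (1 + R)) ^ d"
    unfolding G_def by (rule card_lattice_l1_ball_le[OF R])+
  have sub: "\<phi> ` X \<subseteq> G" using \<phi>G by auto
  show ?thesis
  proof (rule that[of "rep ` \<phi> ` X"])
    show "finite (rep ` \<phi> ` X)" using finite_subset[OF sub finG] by simp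
    show "rep ` \<phi> ` X \<subseteq> X" using rep by auto
    have "card (rep ` \<phi> ` X) \<le> card G"
      using card_image_le[OF finite_subset[OF sub finG], of rep] card_mono[OF finG sub] by linarith
    then show "real (card (rep ` \<phi> ` X)) \<le> (2 * exp 1 * (2 + \<Delta> / r)) ^ d"
      using cardG by (simp add: R_def)
    fix x assume x: "x \<in> X"
    define p where "p = rep (\<phi> x)"
    have same: "\<phi> p = \<phi> x" using rep[OF x] by (simp add: p_def)
    have "edist d x p \<le> sqrt (\<Sum>i<d. h\<^sup>2)"
      unfolding edist_def
    proof (intro real_sqrt_le_mono sum_mono)
      fix i assume i: "i \<in> {..<d}"
      have "\<lfloor>(x i - x0 i) / h\<rfloor> = \<lfloor>(p i - x0 i) / h\<rfloor>"
        using fun_cong[OF same, of i] i by (simp add: \<phi>_def)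
      then have "\<bar>(x i - x0 i) / h - (p i - x0 i) / h\<bar> \<le> 1" by linarith
      then have "\<bar>x i - p i\<bar> \<le> h" using h
        by (simp add: field_simps flip: diff_divide_distrib)
      then show "(x i - p i)\<^sup>2 \<le> h\<^sup>2" using h by (simp add: abs_le_square_iff[symmetric])
    qed
    also have "\<dots> = r" using r d by (simp add: h_def power_divide real_sqrt_divide)
    finally show "\<exists>p\<in>rep ` \<phi> ` X. edist d x p \<le> r" using x by (auto simp: p_def)
  qed
qed

section \<open>Hilbert--Schmidt norms of integral operators\<close>

lemma L2_funs_mult_integrable:
  assumes "u \<in> L2_funs M" "v \<in> L2_funs M"
  shows "integrable M (\<lambda>x. u x * v x)"
proof (rule Bochner_Integration.integrable_bound)
  show "integrable M (\<lambda>x. (u x)\<^sup>2 + (v x)\<^sup>2)" using assms by (auto simp: L2_funs_def)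
  show "(\<lambda>x. u x * v x) \<in> borel_measurable M" using assms by (auto simp: L2_funs_def)
  have "\<bar>a * b\<bar> \<le> a\<^sup>2 + b\<^sup>2" for a b :: real
  proof -
    have "0 \<le> (\<bar>a\<bar> - \<bar>b\<bar>)\<^sup>2" "0 \<le> \<bar>a\<bar> * \<bar>b\<bar>" by auto
    then have "2 * (\<bar>a\<bar> * \<bar>b\<bar>) \<le> a\<^sup>2 + b\<^sup>2" by (simp add: power2_diff)
    with \<open>0 \<le> \<bar>a\<bar> * \<bar>b\<bar>\<close> show ?thesis unfolding abs_mult by linarith
  qed
  then show "AE x in M. norm (u x * v x) \<le> norm ((u x)\<^sup>2 + (v x)\<^sup>2)" by (auto intro!: AE_I2)
qed

text \<open>
  Zorn's lemma gives a maximal orthonormal set. A function orthogonal to all of it that does not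
  vanish almost everywhere could be normalized and added.
\<close>

theorem orthonormal_basis_exists: "\<exists>E. orthonormal_basis M E"
proof -
  define A where "A = {E. E \<subseteq> L2_funs M \<and>
     (\<forall>e\<in>E. \<forall>f\<in>E. (\<integral>x. e x * f x \<partial>M) = (if e = f then 1 else 0))}"
  have "\<exists>E\<in>A. \<forall>X\<in>A. E \<subseteq> X \<longrightarrow> X = E"
  proof (rule subset_Zorn')
    fix C assume C: "subset.chain A C"
    then have sub: "C \<subseteq> A" and tot: "\<And>X Y. X \<in> C \<Longrightarrow> Y \<in> C \<Longrightarrow> X \<subseteq> Y \<or> Y \<subseteq> X"
      by (auto simp: subset_chain_def)
    have "(\<integral>x. e x * f x \<partial>M) = (if e = f then 1 else 0)" if "e \<in> \<Union>C" "f \<in> \<Union>C" for e f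
    proof -
      from that obtain X Y where "X \<in> C" "Y \<in> C" "e \<in> X" "f \<in> Y" by auto
      then obtain Z where "Z \<in> C" "e \<in> Z" "f \<in> Z" using tot[of X Y] by auto
      then show ?thesis using sub unfolding A_def by auto
    qed
    then show "\<Union>C \<in> A" using sub unfolding A_def by blast
  qed
  then obtain E where E: "E \<in> A" and max: "\<And>X. X \<in> A \<Longrightarrow> E \<subseteq> X \<Longrightarrow> X = E" by blast
  have "AE x in M. u x = 0" if u: "u \<in> L2_funs M" and orth: "\<forall>e\<in>E. (\<integral>x. u x * e x \<partial>M) = 0" for u
  proof (rule ccontr)
    assume nz: "\<not> (AE x in M. u x = 0)"
    define I where "I = (\<integral>x. (u x)\<^sup>2 \<partial>M)"
    have int: "integrable M (\<lambda>x. (u x)\<^sup>2)" using u by (simp add: L2_funs_def)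
    have "I \<noteq> 0"
      unfolding I_def using nz by (subst integral_nonneg_eq_0_iff_AE[OF int]) auto
    moreover have "0 \<le> I" by (simp add: I_def)
    ultimately have I: "0 < I" by simp
    define v where "v x = u x / sqrt I" for x
    have v: "v \<in> L2_funs M" using u int I by (simp add: L2_funs_def v_def[abs_def] power_divide)
    have vv: "(\<integral>x. v x * v x \<partial>M) = 1"
    proof -
      have "(\<integral>x. v x * v x \<partial>M) = (\<integral>x. (u x)\<^sup>2 / I \<partial>M)"
        using I by (simp add: v_def power2_eq_square flip: real_sqrt_mult)
      then show ?thesis using I by (simp flip: I_def)
    qed
    have ve: "(\<integral>x. v x * e x \<partial>M) = 0" "(\<integral>x. e x * v x \<partial>M) = 0" if "e \<in> E" for e
      using orth that by (auto simp: v_def mult.commute)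
    have "insert v E \<in> A"
      using E v vv ve unfolding A_def by auto
    then have "v \<in> E" using max[of "insert v E"] by blast
    then show False using ve vv by force
  qed
  then have "orthonormal_basis M E"
    using E unfolding orthonormal_basis_def A_def by blast
  then show ?thesis ..
qed

text \<open>
  The difference of the two sides is the squared distance of \<open>g\<close> from its projection onto the span
  of \<open>F\<close>.
\<close>

lemma Bessel_inequality:
  assumes F: "finite F" "F \<subseteq> L2_funs M"
    and orth: "\<And>e f. e \<in> F \<Longrightarrow> f \<in> F \<Longrightarrow> (\<integral>x. e x * f x \<partial>M) = (if e = f then 1 else 0)"
    and g: "g \<in> L2_funs M"
  shows "(\<Sum>e\<in>F. (\<integral>x. e x * g x \<partial>M)\<^sup>2) \<le> (\<integral>x. (g x)\<^sup>2 \<partial>M)"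
proof -
  define c where "c e = (\<integral>x. e x * g x \<partial>M)" for e
  have ig: "integrable M (\<lambda>x. e x * g x)" if "e \<in> F" for e
    using that F g by (intro L2_funs_mult_integrable) auto
  have ie: "integrable M (\<lambda>x. e x * f x)" if "e \<in> F" "f \<in> F" for e f
    using that F by (intro L2_funs_mult_integrable) auto
  have ig2: "integrable M (\<lambda>x. (g x)\<^sup>2)" using g by (simp add: L2_funs_def)
  have "0 \<le> (\<integral>x. (g x - (\<Sum>e\<in>F. c e * e x))\<^sup>2 \<partial>M)" by simp
  also have "\<dots> = (\<integral>x. (g x)\<^sup>2 - 2 * (\<Sum>e\<in>F. c e * (e x * g x))
      + (\<Sum>e\<in>F. \<Sum>f\<in>F. c e * c f * (e x * f x)) \<partial>M)"
  proof (rule Bochner_Integration.integral_cong[OF refl])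
    fix x
    have "(\<Sum>e\<in>F. c e * (e x * g x)) = g x * (\<Sum>e\<in>F. c e * e x)"
      by (simp add: sum_distrib_left mult_ac)
    moreover have "(\<Sum>e\<in>F. \<Sum>f\<in>F. c e * c f * (e x * f x)) = (\<Sum>e\<in>F. c e * e x)\<^sup>2"
      by (simp add: power2_eq_square sum_product mult_ac)
    ultimately show "(g x - (\<Sum>e\<in>F. c e * e x))\<^sup>2 = (g x)\<^sup>2 - 2 * (\<Sum>e\<in>F. c e * (e x * g x))
      + (\<Sum>e\<in>F. \<Sum>f\<in>F. c e * c f * (e x * f x))"
      by (simp add: power2_diff)
  qed
  also have "\<dots> = (\<integral>x. (g x)\<^sup>2 \<partial>M) - 2 * (\<Sum>e\<in>F. c e * c e)
      + (\<Sum>e\<in>F. \<Sum>f\<in>F. c e * c f * (\<integral>x. e x * f x \<partial>M))"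
    using ig ie ig2 by (simp add: c_def[symmetric])
  also have "(\<Sum>e\<in>F. \<Sum>f\<in>F. c e * c f * (\<integral>x. e x * f x \<partial>M)) = (\<Sum>e\<in>F. c e * c e)"
  proof (rule sum.cong[OF refl])
    fix e assume e: "e \<in> F"
    have "(\<Sum>f\<in>F. c e * c f * (\<integral>x. e x * f x \<partial>M)) = (\<Sum>f\<in>F. if f = e then c e * c e else 0)"
      using e by (intro sum.cong) (auto simp: orth)
    also have "\<dots> = c e * c e" using e F(1) by simp
    finally show "(\<Sum>f\<in>F. c e * c f * (\<integral>x. e x * f x \<partial>M)) = c e * c e" .
  qed
  finally show ?thesis by (simp add: c_def power2_eq_square)
qed

text \<open>
  For fixed \<open>y\<close>, the numbers \<open>A e y\<close> with \<open>e\<close> in an orthonormal basis are the coefficients of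
  \<open>s(\<cdot>, y)\<close>, so by Bessel their squares add up to at most \<open>S\<^sup>2\<close>; integrating over \<open>y\<close> preserves
  this bound. An infinite sum of nonnegative extended reals is the supremum of its finite partial
  sums, so it is enough to treat finite orthonormal families, whatever the cardinality of the basis.
\<close>

theorem hs_norm_le_of_kernel_bound:
  assumes "prob_space M" "prob_space N"
    and s: "(\<lambda>(x, y). s x y) \<in> borel_measurable (M \<Otimes>\<^sub>M N)"
    and bound: "\<And>x y. x \<in> space M \<Longrightarrow> y \<in> space N \<Longrightarrow> \<bar>s x y\<bar> \<le> S"
    and A: "\<And>u y. u \<in> L2_funs M \<Longrightarrow> y \<in> space N \<Longrightarrow> A u y = (\<integral>x. u x * s x y \<partial>M)"
  shows "hs_norm M N A \<le> ennreal S"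
proof -
  interpret M: prob_space M by fact
  interpret N: prob_space N by fact
  obtain x0 y0 where "x0 \<in> space M" "y0 \<in> space N" using M.not_empty N.not_empty by auto
  with bound have S: "0 \<le> S" by fastforce
  define E where "E = (SOME E. orthonormal_basis M E)"
  have "orthonormal_basis M E"
    unfolding E_def using orthonormal_basis_exists by (rule someI_ex)
  then have E: "E \<subseteq> L2_funs M"
    "\<And>e f. e \<in> E \<Longrightarrow> f \<in> E \<Longrightarrow> (\<integral>x. e x * f x \<partial>M) = (if e = f then 1 else 0)"
    by (auto simp: orthonormal_basis_def)
  define T where "T = (\<Sum>\<^sub>\<infinity>e\<in>E. \<integral>\<^sup>+y. ennreal ((A e y)\<^sup>2) \<partial>N)"
  have "(\<Sum>e\<in>F. \<integral>\<^sup>+y. ennreal ((A e y)\<^sup>2) \<partial>N) \<le> ennreal (S\<^sup>2)" if F: "finite F" "F \<subseteq> E" for F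
  proof -
    have meas: "(\<lambda>y. \<integral>x. e x * s x y \<partial>M) \<in> borel_measurable N" if "e \<in> F" for e
    proof -
      have [measurable]: "e \<in> borel_measurable M" using that F E by (auto simp: L2_funs_def)
      note s[measurable]
      have "(\<lambda>p. case p of (y, x) \<Rightarrow> s x y) \<in> borel_measurable (N \<Otimes>\<^sub>M M)"
        using measurable_pair_swap[OF s] by simp
      then have "(\<lambda>(y, x). e x * s x y) \<in> borel_measurable (N \<Otimes>\<^sub>M M)"
        by (simp add: case_prod_beta')
      then show ?thesis by (rule M.borel_measurable_lebesgue_integral)
    qed
    have "(\<Sum>e\<in>F. \<integral>\<^sup>+y. ennreal ((A e y)\<^sup>2) \<partial>N) = (\<Sum>e\<in>F. \<integral>\<^sup>+y. ennreal ((\<integral>x. e x * s x y \<partial>M)\<^sup>2) \<partial>N)"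
      using F E A by (intro sum.cong nn_integral_cong) auto
    also have "\<dots> = (\<integral>\<^sup>+y. (\<Sum>e\<in>F. ennreal ((\<integral>x. e x * s x y \<partial>M)\<^sup>2)) \<partial>N)"
      using meas by (intro nn_integral_sum[symmetric]) auto
    also have "\<dots> \<le> (\<integral>\<^sup>+y. ennreal (S\<^sup>2) \<partial>N)"
    proof (rule nn_integral_mono)
      fix y assume y: "y \<in> space N"
      have sy[measurable]: "(\<lambda>x. s x y) \<in> borel_measurable M"
        using measurable_compose[OF measurable_Pair2'[OF y] s] by simp
      have sq: "(s x y)\<^sup>2 \<le> S\<^sup>2" if "x \<in> space M" for x
        using bound[OF that y] S by (simp add: abs_le_square_iff[symmetric])
      have i: "integrable M (\<lambda>x. (s x y)\<^sup>2)"
        by (rule M.integrable_const_bound[of _ "S\<^sup>2"]) (use sq in \<open>auto intro!: AE_I2\<close>)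
      have "(\<Sum>e\<in>F. (\<integral>x. e x * s x y \<partial>M)\<^sup>2) \<le> (\<integral>x. (s x y)\<^sup>2 \<partial>M)"
      proof (rule Bessel_inequality)
        show "F \<subseteq> L2_funs M" using F E by auto
        show "(\<integral>x. e x * f x \<partial>M) = (if e = f then 1 else 0)" if "e \<in> F" "f \<in> F" for e f
          using that F(2) by (intro E(2)) auto
        show "(\<lambda>x. s x y) \<in> L2_funs M" using sy i by (simp add: L2_funs_def)
      qed fact
      also have "\<dots> \<le> (\<integral>x. S\<^sup>2 \<partial>M)"
        by (rule integral_mono[OF i]) (use sq in auto)
      finally have "(\<Sum>e\<in>F. (\<integral>x. e x * s x y \<partial>M)\<^sup>2) \<le> S\<^sup>2" by (simp add: M.prob_space)
      then show "(\<Sum>e\<in>F. ennreal ((\<integral>x. e x * s x y \<partial>M)\<^sup>2)) \<le> ennreal (S\<^sup>2)"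
        by (simp add: sum_ennreal ennreal_leI)
    qed
    also have "\<dots> = ennreal (S\<^sup>2)" by (simp add: N.emeasure_space_1)
    finally show ?thesis .
  qed
  then have T: "T \<le> ennreal (S\<^sup>2)"
    unfolding T_def by (subst nonneg_infsum_complete) (auto intro!: SUP_least)
  then have "T \<noteq> \<infinity>" using neq_top_trans by force
  moreover have "sqrt (enn2real T) \<le> S"
    using enn2real_leI[OF _ T] S by (simp add: real_le_lsqrt)
  ultimately show ?thesis
    unfolding hs_norm_def T_def E_def Let_def by (simp add: ennreal_leI)
qed

section \<open>A uniform Hoeffding bound\<close>

lemma (in prob_space) Hoeffding_PiM:
  fixes f :: "'a \<Rightarrow> real"
  assumes f[measurable]: "f \<in> borel_measurable M" and b: "AE w in M. f w \<in> {0..B}"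
    and B: "0 < B" and N: "0 < N" and s: "0 \<le> s"
  shows "measure (PiM {..<N} (\<lambda>_. M)) {z \<in> space (PiM {..<N} (\<lambda>_. M)).
      s \<le> \<bar>(\<Sum>i<N. f (z i)) / real N - (\<integral>w. f w \<partial>M)\<bar>} \<le> 2 * exp (- 2 * real N * s\<^sup>2 / B\<^sup>2)"
proof -
  let ?P = "PiM {..<N} (\<lambda>_. M)"
  interpret P: prob_space ?P by (intro prob_space_PiM) unfold_locales
  have d: "distr ?P M (\<lambda>z. z i) = M" if "i < N" for i
    using that by (intro distr_PiM_component) (auto intro: prob_space_axioms)
  have ind: "P.indep_vars (\<lambda>_. M) (\<lambda>i z. z i) {..<N}"
  proof (subst P.indep_vars_iff_distr_eq_PiM')
    show "{..<N} \<noteq> {}" using N by auto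
    have "distr ?P (PiM {..<N} (\<lambda>_. M)) (\<lambda>z. \<lambda>i\<in>{..<N}. z i) = distr ?P ?P (\<lambda>z. z)"
      by (rule distr_cong) (auto simp: space_PiM)
    also have "\<dots> = PiM {..<N} (\<lambda>i. distr ?P M (\<lambda>z. z i))"
      using d by (subst distr_id2) (auto intro!: PiM_cong)
    finally show "distr ?P (PiM {..<N} (\<lambda>_. M)) (\<lambda>z. \<lambda>i\<in>{..<N}. z i) = PiM {..<N} (\<lambda>i. distr ?P M (\<lambda>z. z i))" .
  qed auto
  have ind': "P.indep_vars (\<lambda>_. borel) (\<lambda>i z. f (z i)) {..<N}"
    by (rule P.indep_vars_compose2[OF ind]) auto
  have df: "distr ?P borel (\<lambda>z. f (z i)) = distr M borel f" if "i < N" for i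
  proof -
    have "distr ?P borel (\<lambda>z. f (z i)) = distr (distr ?P M (\<lambda>z. z i)) borel f"
      using that by (subst distr_distr) (auto simp: o_def)
    then show ?thesis using d[OF that] by simp
  qed
  have 0: "0 \<in> {..<N}" using N by simp
  have e: "P.expectation (\<lambda>z. f (z 0)) = (\<integral>w. f w \<partial>M)"
  proof -
    have "P.expectation (\<lambda>z. f (z 0)) = (\<integral>w. f w \<partial>distr ?P M (\<lambda>z. z 0))"
      using 0 by (subst integral_distr) auto
    then show ?thesis using d 0 by simp
  qed
  interpret H: Hoeffding_ineq_iid ?P "{..<N}" "\<lambda>i z. f (z i)" "\<lambda>z. f (z 0)" 0 B "\<integral>w. f w \<partial>M"
  proof unfold_locales
    show "finite {..<N}" by simp
    show "P.indep_vars (\<lambda>_. borel) (\<lambda>i z. f (z i)) {..<N}" by (rule ind')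
    show "distr ?P borel (\<lambda>z. f (z i)) = distr ?P borel (\<lambda>z. f (z 0))" if "i \<in> {..<N}" for i
      using df that 0 by simp
    show "(\<lambda>z. f (z 0)) \<in> borel_measurable ?P" using 0 by measurable
    show "AE z in ?P. f (z 0) \<in> {0..B}"
      using b 0 by (intro AE_PiM_component[where P = "\<lambda>w. f w \<in> {0..B}"]) (auto intro: prob_space_axioms)
    show "(\<integral>w. f w \<partial>M) \<equiv> P.expectation (\<lambda>z. f (z 0))" using e by simp
  qed
  show ?thesis
    using H.Hoeffding_ineq_abs_ge'[OF s B] N by auto
qed

lemma (in prob_space) uniform_Hoeffding:
  fixes f :: "'t \<Rightarrow> 'a \<Rightarrow> real"
  assumes Y: "finite Y" and f: "\<And>\<theta>. \<theta> \<in> Y \<Longrightarrow> f \<theta> \<in> borel_measurable M"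
    and b: "\<And>\<theta>. \<theta> \<in> Y \<Longrightarrow> AE w in M. f \<theta> w \<in> {0..B}"
    and B: "0 < B" and N: "0 < N" and s: "0 \<le> s"
  defines "P \<equiv> PiM {..<N} (\<lambda>_. M)"
  shows "{z \<in> space P. \<forall>\<theta>\<in>Y. \<bar>(\<Sum>i<N. f \<theta> (z i)) / real N - (\<integral>w. f \<theta> w \<partial>M)\<bar> \<le> s} \<in> sets P"
    and "1 - 2 * real (card Y) * exp (- 2 * real N * s\<^sup>2 / B\<^sup>2)
      \<le> measure P {z \<in> space P. \<forall>\<theta>\<in>Y. \<bar>(\<Sum>i<N. f \<theta> (z i)) / real N - (\<integral>w. f \<theta> w \<partial>M)\<bar> \<le> s}"
proof -
  interpret P: prob_space P unfolding P_def by (intro prob_space_PiM) unfold_locales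
  let ?dev = "\<lambda>\<theta> z. \<bar>(\<Sum>i<N. f \<theta> (z i)) / real N - (\<integral>w. f \<theta> w \<partial>M)\<bar>"
  have meas[measurable]: "?dev \<theta> \<in> borel_measurable P" if "\<theta> \<in> Y" for \<theta>
  proof -
    have "(\<lambda>z. f \<theta> (z i)) \<in> borel_measurable P" if "i < N" for i
      
      unfolding P_def using that
      by (intro measurable_compose[OF measurable_component_singleton[of i "{..<N}" "\<lambda>_. M"] f[OF \<open>\<theta> \<in> Y\<close>]]) simp
    then show ?thesis by (intro borel_measurable_abs borel_measurable_diff borel_measurable_divide borel_measurable_sum) auto
  qed
  show G: "{z \<in> space P. \<forall>\<theta>\<in>Y. ?dev \<theta> z \<le> s} \<in> sets P"
    using Y meas by (intro sets.sets_Collect_finite_All) auto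
  let ?bad = "\<lambda>\<theta>. {z \<in> space P. s \<le> ?dev \<theta> z}"
  have bad: "?bad \<theta> \<in> P.events" if "\<theta> \<in> Y" for \<theta> using meas[OF that] by measurable
  have U: "(\<Union>\<theta>\<in>Y. ?bad \<theta>) \<in> P.events" using bad Y by auto
  have "P.prob (\<Union>\<theta>\<in>Y. ?bad \<theta>) \<le> (\<Sum>\<theta>\<in>Y. P.prob (?bad \<theta>))"
    using bad Y by (intro P.finite_measure_subadditive_finite) auto
  also have "\<dots> \<le> (\<Sum>\<theta>\<in>Y. 2 * exp (- 2 * real N * s\<^sup>2 / B\<^sup>2))"
    unfolding P_def using f b B N s by (intro sum_mono Hoeffding_PiM) auto
  finally have "1 - 2 * real (card Y) * exp (- 2 * real N * s\<^sup>2 / B\<^sup>2) \<le> 1 - P.prob (\<Union>\<theta>\<in>Y. ?bad \<theta>)"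
    by simp
  also have "\<dots> = P.prob (space P - (\<Union>\<theta>\<in>Y. ?bad \<theta>))" using P.prob_compl[OF U] by simp
  also have "\<dots> \<le> P.prob {z \<in> space P. \<forall>\<theta>\<in>Y. ?dev \<theta> z \<le> s}"
    by (intro P.finite_measure_mono G) auto
  finally show "1 - 2 * real (card Y) * exp (- 2 * real N * s\<^sup>2 / B\<^sup>2)
      \<le> measure P {z \<in> space P. \<forall>\<theta>\<in>Y. ?dev \<theta> z \<le> s}" .
qed

section \<open>Compact sets and supports\<close>

lemma compact_of_Euclidean_space:
  assumes "compactin (Euclidean_space d) X"
  shows "compact X"
  using assms by (simp add: Euclidean_space_def compactin_subtopology euclidean_product_topology)

lemma continuous_on_edist [continuous_intros]:
  assumes "continuous_on S f" "continuous_on S g"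
  shows "continuous_on S (\<lambda>w. edist d (f w) (g w))"
proof -
  have c: "continuous_on S (\<lambda>w. h w i)" if "continuous_on S h" for h :: "'a \<Rightarrow> point" and i
    using that by (rule continuous_on_product_then_coordinatewise)
  show ?thesis unfolding edist_def by (intro continuous_intros c[OF assms(1)] c[OF assms(2)])
qed

lemma edist_le_ediam:
  assumes "compact X" "x \<in> X" "y \<in> X"
  shows "edist d x y \<le> ediam d X"
proof -
  have "continuous_on (X \<times> X) (\<lambda>(x, y). edist d x y)"
    unfolding case_prod_beta by (intro continuous_intros)
  then have "compact ((\<lambda>(x, y). edist d x y) ` (X \<times> X))"
    using assms by (intro compact_continuous_image compact_Times)
  then have "bdd_above ((\<lambda>(x, y). edist d x y) ` (X \<times> X))"
    by (intro bounded_imp_bdd_above compact_imp_bounded)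
  then have "(\<lambda>(x, y). edist d x y) (x, y) \<le> (SUP (x, y)\<in>X \<times> X. edist d x y)"
    using assms by (intro cSUP_upper) auto
  then show ?thesis using assms by (auto simp: ediam_def)
qed

text \<open>
  Countable dense sets serve two purposes: they show that almost every point lies in the support,
  and they make an event that is quantified over all points of \<open>X\<close> measurable.
\<close>

lemma countable_edist_dense:
  assumes "compact X" "0 < d"
  obtains Q where "countable Q" "Q \<subseteq> X" "\<And>x r. x \<in> X \<Longrightarrow> 0 < r \<Longrightarrow> \<exists>p\<in>Q. edist d x p < r"
proof (cases "X = {}")
  case True
  show ?thesis by (rule that[of "{}"]) (simp_all add: True)
next
  case False
  then obtain x0 where x0: "x0 \<in> X" by auto
  have "\<exists>Y. finite Y \<and> Y \<subseteq> X \<and> (\<forall>x\<in>X. \<exists>p\<in>Y. edist d x p \<le> 1 / real (Suc n))" for n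
  proof -
    have "0 < 1 / real (Suc n)" by simp
    from finite_net[OF x0 edist_le_ediam[OF \<open>compact X\<close>] this \<open>0 < d\<close>] show ?thesis by metis
  qed
  then obtain Y where Y: "\<And>n. finite (Y n)" "\<And>n. Y n \<subseteq> X"
    "\<And>n x. x \<in> X \<Longrightarrow> \<exists>p\<in>Y n. edist d x p \<le> 1 / real (Suc n)" by metis
  show ?thesis
  proof (rule that[of "\<Union>n. Y n"])
    show "countable (\<Union>n. Y n)" using Y(1) by (auto intro: countable_finite)
    show "(\<Union>n. Y n) \<subseteq> X" using Y(2) by auto
    fix x and r :: real assume x: "x \<in> X" and "0 < r"
    then obtain n where n: "1 / real (Suc n) < r" using nat_approx_posE by metis
    obtain p where "p \<in> Y n" "edist d x p \<le> 1 / real (Suc n)" using Y(3)[OF x] by blast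
    then show "\<exists>p\<in>(\<Union>n. Y n). edist d x p < r" using n by (intro bexI[of _ p]) auto
  qed
qed

lemma borel_probD:
  assumes "borel_prob X \<mu>"
  shows "prob_space \<mu>" "sets \<mu> = sets (borel_on X)" "space \<mu> = X"
  using assms sets_eq_imp_space_eq[of \<mu> "borel_on X"] by (auto simp: borel_prob_def space_restrict_space)

lemma eball_in_sets:
  assumes "borel_prob X \<mu>"
  shows "eball d X x r \<in> sets \<mu>"
proof -
  have [measurable]: "(\<lambda>x'. edist d x x') \<in> borel_measurable borel"
    by (intro borel_measurable_continuous_onI continuous_intros)
  have "{x'. edist d x x' < r} \<in> sets borel" by measurable
  moreover have "eball d X x r = X \<inter> {x'. edist d x x' < r}" by (auto simp: eball_def)
  ultimately show ?thesis
    unfolding borel_probD(2)[OF assms] sets_restrict_space by blast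
qed

text \<open>
  A point outside the support is the centre of a null ball. It also lies in a smaller ball, null as
  well, whose centre belongs to a countable dense set and whose radius is \<open>1 / (n + 1)\<close>. There are
  only countably many balls of the latter kind.
\<close>

theorem AE_in_spt:
  assumes \<mu>: "borel_prob X \<mu>" and X: "compact X" and d: "0 < d"
  shows "AE x in \<mu>. x \<in> spt d X \<mu>"
proof -
  interpret prob_space \<mu> using borel_probD(1)[OF \<mu>] .
  obtain Q where Q: "countable Q" "Q \<subseteq> X" "\<And>x r. x \<in> X \<Longrightarrow> 0 < r \<Longrightarrow> \<exists>p\<in>Q. edist d x p < r"
    using countable_edist_dense[OF X d] by metis
  define I where "I = {(p, n). p \<in> Q \<and> measure \<mu> (eball d X p (1 / real (Suc n))) = 0}"
  have "I \<subseteq> Q \<times> UNIV" by (auto simp: I_def)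
  then have I: "countable I" by (rule countable_subset) (use Q(1) in auto)
  have null: "(\<Union>(p, n)\<in>I. eball d X p (1 / real (Suc n))) \<in> null_sets \<mu>"
    using I by (intro null_sets_UN') (auto simp: I_def null_sets_def eball_in_sets[OF \<mu>] emeasure_eq_measure)
  show ?thesis
  proof (rule AE_I'[OF null], safe)
    fix x assume "x \<in> space \<mu>" "x \<notin> spt d X \<mu>"
    then have x: "x \<in> X" using borel_probD(3)[OF \<mu>] by simp
    with \<open>x \<notin> spt d X \<mu>\<close> obtain r where r: "0 < r" "\<not> 0 < measure \<mu> (eball d X x r)"
      by (auto simp: spt_def)
    obtain n where n: "1 / real (Suc n) < r / 2" using nat_approx_posE[of "r / 2"] r by auto
    obtain p where p: "p \<in> Q" "edist d x p < 1 / real (Suc n)" using Q(3)[OF x, of "1 / real (Suc n)"] by auto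
    have "eball d X p (1 / real (Suc n)) \<subseteq> eball d X x r"
    proof
      fix w assume "w \<in> eball d X p (1 / real (Suc n))"
      then show "w \<in> eball d X x r"
        using edist_triangle[of d x w p] p n by (auto simp: eball_def)
    qed
    then have "measure \<mu> (eball d X p (1 / real (Suc n))) \<le> measure \<mu> (eball d X x r)"
      by (intro finite_measure_mono eball_in_sets[OF \<mu>])
    then have "measure \<mu> (eball d X p (1 / real (Suc n))) = 0"
      using r measure_nonneg[of \<mu> "eball d X p (1 / real (Suc n))"] by linarith
    then have "(p, n) \<in> I" using p by (simp add: I_def)
    moreover have "x \<in> eball d X p (1 / real (Suc n))"
      using x p by (simp add: eball_def edist_commute)
    ultimately show "x \<in> (\<Union>(p, n)\<in>I. eball d X p (1 / real (Suc n)))" by blast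
  qed
qed

section \<open>Entropic transport kernels\<close>

lemma abs_exp_diff_le:
  fixes a b m :: real
  assumes "exp a \<le> m" "exp b \<le> m"
  shows "\<bar>exp a - exp b\<bar> \<le> m * \<bar>a - b\<bar>"
proof -
  have *: "exp u - exp v \<le> m * \<bar>u - v\<bar>" if "exp u \<le> m" for u v :: real
  proof -
    have "exp u - exp v = exp u * (1 - exp (v - u))" by (simp add: exp_diff algebra_simps)
    also have "\<dots> \<le> exp u * \<bar>u - v\<bar>"
    proof (rule mult_left_mono)
      show "1 - exp (v - u) \<le> \<bar>u - v\<bar>" using exp_ge_add_one_self[of "v - u"] by linarith
    qed simp
    also have "\<dots> \<le> m * \<bar>u - v\<bar>" using that by (intro mult_right_mono) auto
    finally show ?thesis .
  qed
  show ?thesis using *[OF assms(1), of b] *[OF assms(2), of a] by (simp add: abs_le_iff abs_minus_commute)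
qed

text \<open>
  A kernel built from a solution of the Schroedinger system: the optimality conditions of the dual
  problem, which say that \<open>k\<close> integrates to 1 in each variable. In this form the assumptions are
  invariant under exchanging the two variables.
\<close>

locale schroedinger_kernel =
  fixes d :: nat and X :: "point set" and c :: "point \<Rightarrow> point \<Rightarrow> real" and L \<epsilon> :: real
    and \<rho> \<sigma> :: "point measure" and \<alpha> \<beta> :: "point \<Rightarrow> real" and k :: "point \<Rightarrow> point \<Rightarrow> real"
  assumes compact: "compact X"
    and cost: "lipschitz_cost d X c L"
    and eps: "0 < \<epsilon>"
    and \<rho>: "borel_prob X \<rho>" and \<sigma>: "borel_prob X \<sigma>"
    and cont_\<alpha>: "continuous_on X \<alpha>" and cont_\<beta>: "continuous_on X \<beta>"
    and \<alpha>_eq: "\<And>x. x \<in> X \<Longrightarrow> \<alpha> x = - \<epsilon> * ln (\<integral>y. exp ((\<beta> y - c x y) / \<epsilon>) \<partial>\<sigma>)"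
    and \<beta>_eq: "\<And>y. y \<in> X \<Longrightarrow> \<beta> y = - \<epsilon> * ln (\<integral>x. exp ((\<alpha> x - c x y) / \<epsilon>) \<partial>\<rho>)"
    and k_eq: "\<And>x y. x \<in> X \<Longrightarrow> y \<in> X \<Longrightarrow> k x y = exp ((\<alpha> x + \<beta> y - c x y) / \<epsilon>)"
begin

lemma c_sym: "x \<in> X \<Longrightarrow> y \<in> X \<Longrightarrow> c x y = c y x"
  and L_pos: "0 < L"
  and c_lip: "x \<in> X \<Longrightarrow> x' \<in> X \<Longrightarrow> y \<in> X \<Longrightarrow> \<bar>c x y - c x' y\<bar> \<le> L * edist d x x'"
  and cont_c: "continuous_on (X \<times> X) (\<lambda>(x, y). c x y)"
  using cost by (auto simp: lipschitz_cost_def)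

text \<open>
  The transposed kernel solves the transposed system, so each statement about one variable of \<open>k\<close>
  yields the one about the other.
\<close>

lemma swap: "schroedinger_kernel d X c L \<epsilon> \<sigma> \<rho> \<beta> \<alpha> (\<lambda>x y. k y x)"
proof
  show "\<beta> x = - \<epsilon> * ln (\<integral>y. exp ((\<alpha> y - c x y) / \<epsilon>) \<partial>\<rho>)" if "x \<in> X" for x
  proof -
    have "(\<integral>y. exp ((\<alpha> y - c x y) / \<epsilon>) \<partial>\<rho>) = (\<integral>y. exp ((\<alpha> y - c y x) / \<epsilon>) \<partial>\<rho>)"
      using that by (intro Bochner_Integration.integral_cong) (auto simp: borel_probD(3)[OF \<rho>] c_sym)
    then show ?thesis using \<beta>_eq[OF that] by simp
  qed
  show "\<alpha> y = - \<epsilon> * ln (\<integral>x. exp ((\<beta> x - c x y) / \<epsilon>) \<partial>\<sigma>)" if "y \<in> X" for y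
  proof -
    have "(\<integral>x. exp ((\<beta> x - c x y) / \<epsilon>) \<partial>\<sigma>) = (\<integral>x. exp ((\<beta> x - c y x) / \<epsilon>) \<partial>\<sigma>)"
      using that by (intro Bochner_Integration.integral_cong) (auto simp: borel_probD(3)[OF \<sigma>] c_sym)
    then show ?thesis using \<alpha>_eq[OF that] by simp
  qed
  show "k y x = exp ((\<beta> x + \<alpha> y - c x y) / \<epsilon>)" if "x \<in> X" "y \<in> X" for x y
    using that by (simp add: k_eq c_sym add.commute)
qed (use compact cost eps \<rho> \<sigma> cont_\<alpha> cont_\<beta> in auto)

lemma continuous_on_kernel: "continuous_on (X \<times> X) (\<lambda>(x, y). k x y)"
proof -
  have "continuous_on (X \<times> X) (\<lambda>p. exp ((\<alpha> (fst p) + \<beta> (snd p) - (\<lambda>(x, y). c x y) p) / \<epsilon>))"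
    using eps by (intro continuous_intros cont_c continuous_on_compose2[OF cont_\<alpha>]
        continuous_on_compose2[OF cont_\<beta>]) auto
  then show ?thesis
    by (rule continuous_on_eq) (auto simp: k_eq)
qed

lemma kernel_nonneg: "x \<in> X \<Longrightarrow> y \<in> X \<Longrightarrow> 0 \<le> k x y"
  by (simp add: k_eq)

lemma kernel_bounded:
  obtains B where "\<And>x y. x \<in> X \<Longrightarrow> y \<in> X \<Longrightarrow> k x y \<le> B"
proof -
  have "compact ((\<lambda>(x, y). k x y) ` (X \<times> X))"
    by (intro compact_continuous_image continuous_on_kernel compact_Times compact)
  then have "bounded ((\<lambda>(x, y). k x y) ` (X \<times> X))" by (rule compact_imp_bounded)
  then obtain B where "\<forall>v\<in>(\<lambda>(x, y). k x y) ` (X \<times> X). norm v \<le> B" unfolding bounded_iff by blast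
  then show ?thesis by (intro that[of B]) fastforce
qed

lemma kernel_measurable: "(\<lambda>(x, y). k x y) \<in> borel_measurable (borel_on X \<Otimes>\<^sub>M borel_on X)"
proof -
  have i: "(\<lambda>x. x) \<in> measurable (borel_on X) borel" by (rule measurable_restrict_space1) simp
  have "(\<lambda>p. (fst p, snd p)) \<in> measurable (borel_on X \<Otimes>\<^sub>M borel_on X) (borel \<Otimes>\<^sub>M borel)"
    by (intro measurable_Pair measurable_compose[OF measurable_fst i] measurable_compose[OF measurable_snd i])
  then have "(\<lambda>p. p) \<in> measurable (borel_on X \<Otimes>\<^sub>M borel_on X) (borel :: (point \<times> point) measure)"
    by (simp add: borel_prod)
  then have "(\<lambda>p. p) \<in> measurable (borel_on X \<Otimes>\<^sub>M borel_on X) (restrict_space borel (X \<times> X))"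
    by (rule measurable_restrict_space2[rotated]) (auto simp: space_pair_measure space_restrict_space)
  from measurable_compose[OF this borel_measurable_continuous_on_restrict[OF continuous_on_kernel]]
  show ?thesis by simp
qed

text \<open>
  As \<open>ln\<close> is 0 at 0, the equation for \<open>\<alpha>\<close> can be exponentiated only once the integral is known to
  be positive; the integrand is continuous on a compact set, hence bounded away from 0.
\<close>

lemma potential_integral:
  assumes x: "x \<in> X"
  shows "integrable \<sigma> (\<lambda>y. exp ((\<beta> y - c x y) / \<epsilon>))"
    and "exp (- \<alpha> x / \<epsilon>) = (\<integral>y. exp ((\<beta> y - c x y) / \<epsilon>) \<partial>\<sigma>)"
proof -
  interpret prob_space \<sigma> using borel_probD(1)[OF \<sigma>] .
  have sp: "space \<sigma> = X" using borel_probD(3)[OF \<sigma>] .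
  let ?h = "\<lambda>y. exp ((\<beta> y - c x y) / \<epsilon>)"
  have "continuous_on X (\<lambda>y. (\<lambda>(x, y). c x y) (x, y))"
    by (rule continuous_on_compose2[OF cont_c]) (use x in \<open>auto intro!: continuous_intros\<close>)
  then have cont: "continuous_on X ?h"
    using eps by (intro continuous_intros cont_\<beta>) auto
  have "X \<noteq> {}" using x by auto
  obtain a where a: "a \<in> X" "\<And>y. y \<in> X \<Longrightarrow> ?h a \<le> ?h y"
    using continuous_attains_inf[OF compact \<open>X \<noteq> {}\<close> cont] by blast
  obtain b where b: "b \<in> X" "\<And>y. y \<in> X \<Longrightarrow> ?h y \<le> ?h b"
    using continuous_attains_sup[OF compact \<open>X \<noteq> {}\<close> cont] by blast
  have "?h \<in> borel_measurable \<sigma>"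
    using borel_measurable_continuous_on_restrict[OF cont]
    by (simp add: measurable_cong_sets[OF borel_probD(2)[OF \<sigma>] refl])
  then show int: "integrable \<sigma> ?h"
    by (rule integrable_const_bound[rotated, where B = "?h b"]) (use b sp in auto)
  have "?h a \<le> (\<integral>y. ?h y \<partial>\<sigma>)"
    by (rule integral_ge_const[OF int]) (use a sp in auto)
  then have "0 < (\<integral>y. ?h y \<partial>\<sigma>)" using exp_gt_zero less_le_trans by blast
  then show "exp (- \<alpha> x / \<epsilon>) = (\<integral>y. ?h y \<partial>\<sigma>)"
    using \<alpha>_eq[OF x] eps by simp
qed

lemma kernel_marginal:
  assumes x: "x \<in> X"
  shows "integrable \<sigma> (\<lambda>y. k x y)" and "(\<integral>y. k x y \<partial>\<sigma>) = 1"
proof -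
  have sp: "space \<sigma> = X" using borel_probD(3)[OF \<sigma>] .
  have eq: "k x y = exp (\<alpha> x / \<epsilon>) * exp ((\<beta> y - c x y) / \<epsilon>)" if "y \<in> X" for y
    using that x by (simp add: k_eq add_divide_distrib diff_divide_distrib flip: exp_add)
  have "integrable \<sigma> (\<lambda>y. exp (\<alpha> x / \<epsilon>) * exp ((\<beta> y - c x y) / \<epsilon>))"
    using potential_integral(1)[OF x] by simp
  then show "integrable \<sigma> (\<lambda>y. k x y)"
    by (rule Bochner_Integration.integrable_cong[THEN iffD2, rotated -1]) (auto simp: sp eq)
  have "(\<integral>y. k x y \<partial>\<sigma>) = (\<integral>y. exp (\<alpha> x / \<epsilon>) * exp ((\<beta> y - c x y) / \<epsilon>) \<partial>\<sigma>)"
    by (intro Bochner_Integration.integral_cong) (auto simp: sp eq)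
  also have "\<dots> = exp (\<alpha> x / \<epsilon>) * exp (- \<alpha> x / \<epsilon>)"
    by (simp add: potential_integral(2)[OF x, symmetric])
  also have "\<dots> = 1" by (simp flip: exp_add)
  finally show "(\<integral>y. k x y \<partial>\<sigma>) = 1" .
qed

text \<open>
  Moving \<open>x\<close> changes \<open>c x y\<close> by at most \<open>L * edist d x x'\<close> for all \<open>y\<close> at once, and this amount
  passes unchanged through the soft minimum.
\<close>

lemma potential_lipschitz:
  assumes x: "x \<in> X" and x': "x' \<in> X"
  shows "\<bar>\<alpha> x - \<alpha> x'\<bar> \<le> L * edist d x x'"
proof -
  have *: "\<alpha> v - \<alpha> u \<le> L * edist d u v" if u: "u \<in> X" and v: "v \<in> X" for u v
  proof -
    let ?D = "L * edist d u v"
    have "exp (- \<alpha> u / \<epsilon>) = (\<integral>y. exp ((\<beta> y - c u y) / \<epsilon>) \<partial>\<sigma>)" by (rule potential_integral(2)[OF u])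
    also have "\<dots> \<le> (\<integral>y. exp (?D / \<epsilon>) * exp ((\<beta> y - c v y) / \<epsilon>) \<partial>\<sigma>)"
    proof (rule integral_mono)
      show "integrable \<sigma> (\<lambda>y. exp ((\<beta> y - c u y) / \<epsilon>))" by (rule potential_integral(1)[OF u])
      show "integrable \<sigma> (\<lambda>y. exp (?D / \<epsilon>) * exp ((\<beta> y - c v y) / \<epsilon>))"
        using potential_integral(1)[OF v] by simp
      fix y assume "y \<in> space \<sigma>"
      then have y: "y \<in> X" using borel_probD(3)[OF \<sigma>] by simp
      have "\<beta> y - c u y \<le> ?D + (\<beta> y - c v y)" using c_lip[OF u v y] by linarith
      then have "(\<beta> y - c u y) / \<epsilon> \<le> ?D / \<epsilon> + (\<beta> y - c v y) / \<epsilon>"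
        using eps by (simp add: divide_right_mono flip: add_divide_distrib)
      then show "exp ((\<beta> y - c u y) / \<epsilon>) \<le> exp (?D / \<epsilon>) * exp ((\<beta> y - c v y) / \<epsilon>)"
        by (simp flip: exp_add)
    qed
    also have "\<dots> = exp (?D / \<epsilon>) * exp (- \<alpha> v / \<epsilon>)"
      by (simp add: potential_integral(2)[OF v, symmetric])
    finally have "- \<alpha> u / \<epsilon> \<le> (?D - \<alpha> v) / \<epsilon>" by (simp add: diff_divide_distrib flip: exp_add)
    then have "- \<alpha> u \<le> ?D - \<alpha> v" using eps by (subst (asm) divide_le_cancel) auto
    then show ?thesis by simp
  qed
  show ?thesis using *[OF x x'] *[OF x' x] by (simp add: edist_commute abs_le_iff)
qed

lemma log_kernel_lipschitz:
  assumes x: "x \<in> X" and x': "x' \<in> X" and y: "y \<in> X"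
  shows "\<bar>(\<alpha> x + \<beta> y - c x y) / \<epsilon> - (\<alpha> x' + \<beta> y - c x' y) / \<epsilon>\<bar> \<le> 2 * L / \<epsilon> * edist d x x'"
proof -
  have "\<bar>(\<alpha> x + \<beta> y - c x y) - (\<alpha> x' + \<beta> y - c x' y)\<bar> \<le> 2 * L * edist d x x'"
    using potential_lipschitz[OF x x'] c_lip[OF x x' y] by linarith
  then have "\<bar>(\<alpha> x + \<beta> y - c x y) - (\<alpha> x' + \<beta> y - c x' y)\<bar> / \<epsilon> \<le> 2 * L * edist d x x' / \<epsilon>"
    using eps by (intro divide_right_mono) auto
  moreover have "\<bar>(\<alpha> x + \<beta> y - c x y) - (\<alpha> x' + \<beta> y - c x' y)\<bar> / \<epsilon>
      = \<bar>(\<alpha> x + \<beta> y - c x y) / \<epsilon> - (\<alpha> x' + \<beta> y - c x' y) / \<epsilon>\<bar>"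
    using eps by (simp add: abs_divide flip: diff_divide_distrib)
  ultimately show ?thesis by simp
qed

text \<open>
  The hypothesis bounds \<open>k\<close> only at the two points concerned. The Lipschitz constant is thus
  proportional to the sharp bound where \<open>y\<close> lies in the support, and still finite elsewhere.
\<close>

lemma kernel_lipschitz:
  assumes x: "x \<in> X" and x': "x' \<in> X" and y: "y \<in> X" and b: "k x y \<le> b" "k x' y \<le> b"
  shows "\<bar>k x y - k x' y\<bar> \<le> b * (2 * L / \<epsilon> * edist d x x')"
proof -
  have "0 \<le> b" using kernel_nonneg[OF x y] b by linarith
  have "\<bar>k x y - k x' y\<bar> \<le> b * \<bar>(\<alpha> x + \<beta> y - c x y) / \<epsilon> - (\<alpha> x' + \<beta> y - c x' y) / \<epsilon>\<bar>"
    using b abs_exp_diff_le by (simp add: k_eq x x' y)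
  also have "\<dots> \<le> b * (2 * L / \<epsilon> * edist d x x')"
    using log_kernel_lipschitz[OF x x' y] \<open>0 \<le> b\<close> by (rule mult_left_mono)
  finally show ?thesis .
qed

text \<open>
  On the ball of radius \<open>\<delta> = min \<epsilon> \<delta>\<^sub>0\<close> around \<open>y\<close>, the kernel \<open>k x\<close> is at least
  \<open>exp (- 2 * L) * k x y\<close>. Since it integrates to 1, the mass of the ball bounds \<open>k x y\<close>. The radius
  \<open>\<epsilon>\<close> balances the oscillation \<open>exp (2 * L * \<delta> / \<epsilon>)\<close> against the mass; for \<open>\<epsilon> > \<delta>\<^sub>0\<close> the ball-mass
  assumption stops at \<open>\<delta>\<^sub>0\<close>, and the scale factor is the loss.
\<close>

lemma kernel_le_on_spt:
  assumes bm: "ball_mass d X \<sigma> C D \<delta>\<^sub>0" and x: "x \<in> X" and y: "y \<in> spt d X \<sigma>"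
  shows "k x y \<le> exp (2 * L) / C * (scale_factor D \<delta>\<^sub>0 \<epsilon> / \<epsilon> powr D)"
proof -
  interpret prob_space \<sigma> using borel_probD(1)[OF \<sigma>] .
  have sp: "space \<sigma> = X" using borel_probD(3)[OF \<sigma>] .
  have yX: "y \<in> X" using y by (simp add: spt_def)
  have C: "0 < C" and \<delta>0: "0 < \<delta>\<^sub>0" using bm by (auto simp: ball_mass_def)
  define \<delta> where "\<delta> = min \<epsilon> \<delta>\<^sub>0"
  have \<delta>: "0 < \<delta>" "\<delta> \<le> \<delta>\<^sub>0" "\<delta> \<le> \<epsilon>" using eps \<delta>0 by (auto simp: \<delta>_def)
  define U where "U = eball d X y \<delta>"
  have U: "U \<in> sets \<sigma>" unfolding U_def by (rule eball_in_sets[OF \<sigma>])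
  have mass: "C * \<delta> powr D \<le> measure \<sigma> U"
    using bm \<delta> y by (auto simp: ball_mass_def U_def)
  interpret S: schroedinger_kernel d X c L \<epsilon> \<sigma> \<rho> \<beta> \<alpha> "\<lambda>x y. k y x" by (rule swap)
  have low: "exp (- 2 * L) * k x y \<le> k x y'" if "y' \<in> U" for y'
  proof -
    have y': "y' \<in> X" "edist d y y' < \<delta>" using that by (auto simp: U_def eball_def)
    have "2 * L / \<epsilon> * edist d y y' \<le> 2 * L / \<epsilon> * \<epsilon>"
      using y' \<delta> L_pos eps by (intro mult_left_mono) auto
    then have "2 * L / \<epsilon> * edist d y y' \<le> 2 * L" using eps by simp
    then have "(\<beta> y + \<alpha> x - c y x) / \<epsilon> - 2 * L \<le> (\<beta> y' + \<alpha> x - c y' x) / \<epsilon>"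
      using S.log_kernel_lipschitz[OF yX y'(1) x] by linarith
    then have "exp (- 2 * L + (\<beta> y + \<alpha> x - c y x) / \<epsilon>) \<le> exp ((\<beta> y' + \<alpha> x - c y' x) / \<epsilon>)" by simp
    then show ?thesis using S.k_eq[OF yX x] S.k_eq[OF y'(1) x] by (simp only: exp_add)
  qed
  have k0: "0 \<le> k x y" by (rule kernel_nonneg[OF x yX])
  have "exp (- 2 * L) * k x y * (C * \<delta> powr D) \<le> exp (- 2 * L) * k x y * measure \<sigma> U"
    using mass k0 by (intro mult_left_mono) auto
  also have "\<dots> = (\<integral>y'. exp (- 2 * L) * k x y * indicator U y' \<partial>\<sigma>)"
    using U by simp
  also have "\<dots> \<le> (\<integral>y'. k x y' \<partial>\<sigma>)"
  proof (rule integral_mono[OF _ kernel_marginal(1)[OF x]])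
    show "integrable \<sigma> (\<lambda>y'. exp (- 2 * L) * k x y * indicator U y')"
      using U by (intro integrable_mult_right integrable_real_indicator) (auto simp: emeasure_eq_measure)
    show "exp (- 2 * L) * k x y * indicator U y' \<le> k x y'" if "y' \<in> space \<sigma>" for y'
      using low[of y'] kernel_nonneg[OF x, of y'] that sp by (auto simp: indicator_def)
  qed
  also have "\<dots> = 1" by (rule kernel_marginal(2)[OF x])
  finally have "exp (- 2 * L) * k x y * (C * \<delta> powr D) \<le> 1" .
  then have "k x y \<le> exp (2 * L) / (C * \<delta> powr D)"
    using C \<delta> by (simp add: field_simps exp_minus)
  also have "\<delta> powr D = \<epsilon> powr D / scale_factor D \<delta>\<^sub>0 \<epsilon>"
  proof -
    have "\<delta> * max 1 (\<epsilon> / \<delta>\<^sub>0) = \<epsilon>"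
      using eps \<delta>0 by (auto simp: \<delta>_def min_def max_def field_simps)
    then have "\<epsilon> powr D = \<delta> powr D * max 1 (\<epsilon> / \<delta>\<^sub>0) powr D"
      using \<delta> by (metis less_imp_le max.cobounded1 order_trans powr_mult zero_le_one)
    then show ?thesis by (simp add: scale_factor_def)
  qed
  finally show ?thesis by simp
qed

end

section \<open>Transfer kernels\<close>

text \<open>
  The two kernels that a transfer kernel is made of. The measure \<open>Q\<close> below stands for both the
  coupling and an empirical measure, the two of which are compared in the end.
\<close>

locale kernel_pair =
  K1: schroedinger_kernel d X c L \<epsilon> \<mu> \<mu> \<alpha>\<^sub>1 \<beta>\<^sub>1 k\<^sub>1 + K2: schroedinger_kernel d X c L \<epsilon> \<nu> \<nu> \<alpha>\<^sub>2 \<beta>\<^sub>2 k\<^sub>2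
  for d X c L \<epsilon> \<mu> \<nu> \<alpha>\<^sub>1 \<beta>\<^sub>1 k\<^sub>1 \<alpha>\<^sub>2 \<beta>\<^sub>2 k\<^sub>2
begin

abbreviation W :: "(point \<times> point) measure" where "W \<equiv> borel_on X \<Otimes>\<^sub>M borel_on X"

lemma space_W: "space W = X \<times> X"
  by (simp add: space_pair_measure space_restrict_space)

lemma integrand_measurable_joint:
  "(\<lambda>(p, w). k\<^sub>1 (fst p) (fst w) * k\<^sub>2 (snd w) (snd p)) \<in> borel_measurable (W \<Otimes>\<^sub>M W)"
proof -
  have 1: "(\<lambda>q. (fst (fst q), fst (snd q))) \<in> measurable (W \<Otimes>\<^sub>M W) W"
    and 2: "(\<lambda>q. (snd (snd q), snd (fst q))) \<in> measurable (W \<Otimes>\<^sub>M W) W" by measurable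
  have "(\<lambda>q. k\<^sub>1 (fst (fst q)) (fst (snd q))) \<in> borel_measurable (W \<Otimes>\<^sub>M W)"
    using measurable_compose[OF 1 K1.kernel_measurable] by simp
  moreover have "(\<lambda>q. k\<^sub>2 (snd (snd q)) (snd (fst q))) \<in> borel_measurable (W \<Otimes>\<^sub>M W)"
    using measurable_compose[OF 2 K2.kernel_measurable] by simp
  ultimately show ?thesis unfolding case_prod_beta by (rule borel_measurable_times)
qed

lemma integrand_measurable:
  assumes "x \<in> X" "y \<in> X"
  shows "(\<lambda>(x', y'). k\<^sub>1 x x' * k\<^sub>2 y' y) \<in> borel_measurable W"
proof -
  have "(\<lambda>w. ((x, y), w)) \<in> measurable W (W \<Otimes>\<^sub>M W)"
    by (rule measurable_Pair1') (use assms space_W in auto)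
  from measurable_compose[OF this integrand_measurable_joint] show ?thesis
    by (simp add: case_prod_beta)
qed

lemma integrand_bounds:
  assumes "x \<in> X" "y \<in> X" "w \<in> X \<times> X" "k\<^sub>1 x (fst w) \<le> b\<^sub>1" "k\<^sub>2 (snd w) y \<le> b\<^sub>2"
  shows "0 \<le> k\<^sub>1 x (fst w) * k\<^sub>2 (snd w) y" "k\<^sub>1 x (fst w) * k\<^sub>2 (snd w) y \<le> b\<^sub>1 * b\<^sub>2"
proof -
  have "0 \<le> k\<^sub>1 x (fst w)" "0 \<le> k\<^sub>2 (snd w) y"
    using assms by (auto intro: K1.kernel_nonneg K2.kernel_nonneg)
  then show "0 \<le> k\<^sub>1 x (fst w) * k\<^sub>2 (snd w) y" "k\<^sub>1 x (fst w) * k\<^sub>2 (snd w) y \<le> b\<^sub>1 * b\<^sub>2"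
    using assms by (auto intro!: mult_mono)
qed

text \<open>
  The integrand as a function of \<open>(x, y)\<close>, for a single sample point \<open>w\<close>. Only bounds at this \<open>w\<close>
  enter, so that the estimate can be used both with sharp bounds for \<open>w\<close> in the supports and with
  global ones for all \<open>w\<close>.
\<close>

lemma integrand_lipschitz:
  assumes X: "x \<in> X" "y \<in> X" "p \<in> X" "q \<in> X" "w \<in> X \<times> X"
    and b: "\<And>x. x \<in> X \<Longrightarrow> k\<^sub>1 x (fst w) \<le> b\<^sub>1" "\<And>y. y \<in> X \<Longrightarrow> k\<^sub>2 (snd w) y \<le> b\<^sub>2"
  shows "\<bar>k\<^sub>1 x (fst w) * k\<^sub>2 (snd w) y - k\<^sub>1 p (fst w) * k\<^sub>2 (snd w) q\<bar>
    \<le> b\<^sub>1 * b\<^sub>2 * (2 * L / \<epsilon>) * (edist d x p + edist d y q)"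
proof -
  interpret S2: schroedinger_kernel d X c L \<epsilon> \<nu> \<nu> \<beta>\<^sub>2 \<alpha>\<^sub>2 "\<lambda>x y. k\<^sub>2 y x" by (rule K2.swap)
  have w: "fst w \<in> X" "snd w \<in> X" using X by auto
  have L: "0 \<le> 2 * L / \<epsilon>" using K1.L_pos K1.eps by simp
  have b0: "0 \<le> b\<^sub>1" "0 \<le> b\<^sub>2"
    using K1.kernel_nonneg[OF X(1) w(1)] b(1)[OF X(1)] K2.kernel_nonneg[OF w(2) X(2)] b(2)[OF X(2)] by auto
  have "k\<^sub>1 x (fst w) * k\<^sub>2 (snd w) y - k\<^sub>1 p (fst w) * k\<^sub>2 (snd w) q
      = (k\<^sub>1 x (fst w) - k\<^sub>1 p (fst w)) * k\<^sub>2 (snd w) y + k\<^sub>1 p (fst w) * (k\<^sub>2 (snd w) y - k\<^sub>2 (snd w) q)"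
    by (simp add: algebra_simps)
  then have "\<bar>k\<^sub>1 x (fst w) * k\<^sub>2 (snd w) y - k\<^sub>1 p (fst w) * k\<^sub>2 (snd w) q\<bar>
      \<le> \<bar>k\<^sub>1 x (fst w) - k\<^sub>1 p (fst w)\<bar> * k\<^sub>2 (snd w) y + k\<^sub>1 p (fst w) * \<bar>k\<^sub>2 (snd w) y - k\<^sub>2 (snd w) q\<bar>"
    using K2.kernel_nonneg[OF w(2) X(2)] K1.kernel_nonneg[OF X(3) w(1)]
    by (metis abs_mult abs_of_nonneg abs_triangle_ineq)
  also have "\<dots> \<le> b\<^sub>1 * (2 * L / \<epsilon> * edist d x p) * b\<^sub>2 + b\<^sub>1 * (b\<^sub>2 * (2 * L / \<epsilon> * edist d y q))"
    using K1.kernel_lipschitz[OF X(1,3) w(1) b(1) b(1)] S2.kernel_lipschitz[OF X(2,4) w(2) b(2) b(2)]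
      K2.kernel_nonneg[OF w(2) X(2)] K1.kernel_nonneg[OF X(3) w(1)] b(1)[OF X(3)] b(2)[OF X(2)] b0 L X
    by (intro add_mono mult_mono mult_nonneg_nonneg edist_nonneg) auto
  also have "\<dots> = b\<^sub>1 * b\<^sub>2 * (2 * L / \<epsilon>) * (edist d x p + edist d y q)"
    by (simp add: algebra_simps add_divide_distrib)
  finally show ?thesis .
qed

lemma integrand_integrable:
  assumes Q: "prob_space Q" "sets Q = sets W" and X: "x \<in> X" "y \<in> X"
  shows "integrable Q (\<lambda>(x', y'). k\<^sub>1 x x' * k\<^sub>2 y' y)"
proof -
  interpret prob_space Q by fact
  have sp: "space Q = X \<times> X" using sets_eq_imp_space_eq[OF Q(2)] space_W by simp
  obtain G\<^sub>1 where G1: "\<And>x y. x \<in> X \<Longrightarrow> y \<in> X \<Longrightarrow> k\<^sub>1 x y \<le> G\<^sub>1" using K1.kernel_bounded by blast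
  obtain G\<^sub>2 where G2: "\<And>x y. x \<in> X \<Longrightarrow> y \<in> X \<Longrightarrow> k\<^sub>2 x y \<le> G\<^sub>2" using K2.kernel_bounded by blast
  show ?thesis
  proof (rule integrable_const_bound[of _ "G\<^sub>1 * G\<^sub>2"])
    show "AE w in Q. norm (case w of (x', y') \<Rightarrow> k\<^sub>1 x x' * k\<^sub>2 y' y) \<le> G\<^sub>1 * G\<^sub>2"
    proof (rule AE_I2)
      fix w assume "w \<in> space Q"
      then have w: "w \<in> X \<times> X" using sp by simp
      show "norm (case w of (x', y') \<Rightarrow> k\<^sub>1 x x' * k\<^sub>2 y' y) \<le> G\<^sub>1 * G\<^sub>2"
        using integrand_bounds[OF X w, of G\<^sub>1 G\<^sub>2] G1 G2 X w by (auto simp: case_prod_beta)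
    qed
    show "(\<lambda>(x', y'). k\<^sub>1 x x' * k\<^sub>2 y' y) \<in> borel_measurable Q"
      using integrand_measurable[OF X] by (simp add: measurable_cong_sets[OF Q(2) refl])
  qed
qed

lemma transfer_kernel_lipschitz:
  assumes Q: "prob_space Q" "sets Q = sets W" and X: "x \<in> X" "y \<in> X" "p \<in> X" "q \<in> X"
    and b: "AE w in Q. (\<forall>x\<in>X. k\<^sub>1 x (fst w) \<le> b\<^sub>1) \<and> (\<forall>y\<in>X. k\<^sub>2 (snd w) y \<le> b\<^sub>2)"
  shows "\<bar>transfer_kernel k\<^sub>1 k\<^sub>2 Q x y - transfer_kernel k\<^sub>1 k\<^sub>2 Q p q\<bar>
    \<le> b\<^sub>1 * b\<^sub>2 * (2 * L / \<epsilon>) * (edist d x p + edist d y q)" (is "_ \<le> ?K")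
proof -
  interpret prob_space Q by fact
  have sp: "space Q = X \<times> X" using sets_eq_imp_space_eq[OF Q(2)] space_W by simp
  let ?f = "\<lambda>x y w. k\<^sub>1 x (fst w) * k\<^sub>2 (snd w) y"
  have i: "integrable Q (?f x y)" if "x \<in> X" "y \<in> X" for x y
    using integrand_integrable[OF Q that] by (simp add: case_prod_beta')
  have "transfer_kernel k\<^sub>1 k\<^sub>2 Q x y - transfer_kernel k\<^sub>1 k\<^sub>2 Q p q = (\<integral>w. ?f x y w - ?f p q w \<partial>Q)"
    using i X by (simp add: transfer_kernel_def case_prod_beta')
  also have "\<bar>\<dots>\<bar> \<le> (\<integral>w. \<bar>?f x y w - ?f p q w\<bar> \<partial>Q)" by (rule integral_abs_bound)
  also have "\<dots> \<le> ?K"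
  proof (rule integral_le_const)
    show "integrable Q (\<lambda>w. \<bar>?f x y w - ?f p q w\<bar>)" using i X by auto
    show "AE w in Q. \<bar>?f x y w - ?f p q w\<bar> \<le> ?K"
      using b AE_space
    proof eventually_elim
      case (elim w)
      then show ?case using sp by (intro integrand_lipschitz X) auto
    qed
  qed
  finally show ?thesis .
qed

lemma transfer_kernel_measurable:
  assumes Q: "prob_space Q" "sets Q = sets W"
  shows "(\<lambda>(x, y). transfer_kernel k\<^sub>1 k\<^sub>2 Q x y) \<in> borel_measurable W"
proof -
  interpret prob_space Q by fact
  have "(\<lambda>(p, w). k\<^sub>1 (fst p) (fst w) * k\<^sub>2 (snd w) (snd p)) \<in> borel_measurable (W \<Otimes>\<^sub>M Q)"
    using integrand_measurable_joint
    by (simp add: measurable_cong_sets[OF sets_pair_measure_cong[OF refl Q(2)] refl])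
  from borel_measurable_lebesgue_integral[OF this] show ?thesis
    by (simp add: transfer_kernel_def case_prod_beta')
qed

lemma transfer_kernel_bounded:
  assumes Q: "prob_space Q" "sets Q = sets W"
  obtains G where "\<And>x y. x \<in> X \<Longrightarrow> y \<in> X \<Longrightarrow> \<bar>transfer_kernel k\<^sub>1 k\<^sub>2 Q x y\<bar> \<le> G"
proof -
  interpret prob_space Q by fact
  have sp: "space Q = X \<times> X" using sets_eq_imp_space_eq[OF Q(2)] space_W by simp
  obtain G\<^sub>1 where G1: "\<And>x y. x \<in> X \<Longrightarrow> y \<in> X \<Longrightarrow> k\<^sub>1 x y \<le> G\<^sub>1" using K1.kernel_bounded by blast
  obtain G\<^sub>2 where G2: "\<And>x y. x \<in> X \<Longrightarrow> y \<in> X \<Longrightarrow> k\<^sub>2 x y \<le> G\<^sub>2" using K2.kernel_bounded by blast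
  show ?thesis
  proof (rule that)
    fix x y assume X: "x \<in> X" "y \<in> X"
    have i: "integrable Q (\<lambda>w. k\<^sub>1 x (fst w) * k\<^sub>2 (snd w) y)"
      using integrand_integrable[OF Q X] by (simp add: case_prod_beta')
    have "\<bar>transfer_kernel k\<^sub>1 k\<^sub>2 Q x y\<bar> \<le> (\<integral>w. \<bar>k\<^sub>1 x (fst w) * k\<^sub>2 (snd w) y\<bar> \<partial>Q)"
      unfolding transfer_kernel_def case_prod_beta' by (rule integral_abs_bound)
    also have "\<dots> \<le> G\<^sub>1 * G\<^sub>2"
    proof (rule integral_le_const)
      show "integrable Q (\<lambda>w. \<bar>k\<^sub>1 x (fst w) * k\<^sub>2 (snd w) y\<bar>)" using i by simp
      show "AE w in Q. \<bar>k\<^sub>1 x (fst w) * k\<^sub>2 (snd w) y\<bar> \<le> G\<^sub>1 * G\<^sub>2"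
      proof (rule AE_I2)
        fix w assume "w \<in> space Q"
        then have w: "w \<in> X \<times> X" using sp by simp
        show "\<bar>k\<^sub>1 x (fst w) * k\<^sub>2 (snd w) y\<bar> \<le> G\<^sub>1 * G\<^sub>2"
          using integrand_bounds[OF X w, of G\<^sub>1 G\<^sub>2] G1 G2 X w by auto
      qed
    qed
    finally show "\<bar>transfer_kernel k\<^sub>1 k\<^sub>2 Q x y\<bar> \<le> G\<^sub>1 * G\<^sub>2" .
  qed
qed

lemma hs_norm_transfer_diff_le_sup_norm:
  assumes Q: "prob_space Q" "sets Q = sets W" and R: "prob_space R" "sets R = sets W"
  shows "hs_norm \<mu> \<nu> (op_diff (kernel_op \<mu> (transfer_kernel k\<^sub>1 k\<^sub>2 Q)) (kernel_op \<mu> (transfer_kernel k\<^sub>1 k\<^sub>2 R)))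
    \<le> sup_norm X (\<lambda>x y. transfer_kernel k\<^sub>1 k\<^sub>2 Q x y - transfer_kernel k\<^sub>1 k\<^sub>2 R x y)"
    (is "_ \<le> sup_norm X ?s")
proof (cases "sup_norm X ?s = \<infinity>")
  case False
  note \<mu> = borel_probD[OF K1.\<rho>] and \<nu> = borel_probD[OF K2.\<rho>]
  interpret M: prob_space \<mu> by (rule \<mu>(1))
  define S where "S = enn2real (sup_norm X ?s)"
  have S: "sup_norm X ?s = ennreal S" using False by (simp add: S_def less_top)
  have setsW: "sets (\<mu> \<Otimes>\<^sub>M \<nu>) = sets W" by (intro sets_pair_measure_cong \<mu> \<nu>)
  have prod: "integrable \<mu> (\<lambda>x. u x * transfer_kernel k\<^sub>1 k\<^sub>2 T x y)"
    if T: "prob_space T" "sets T = sets W" and u: "u \<in> L2_funs \<mu>" and y: "y \<in> space \<nu>" for T u y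
  proof -
    obtain G where G: "\<And>x y. x \<in> X \<Longrightarrow> y \<in> X \<Longrightarrow> \<bar>transfer_kernel k\<^sub>1 k\<^sub>2 T x y\<bar> \<le> G"
      using transfer_kernel_bounded[OF T] by blast
    have "(\<lambda>(x, y). transfer_kernel k\<^sub>1 k\<^sub>2 T x y) \<in> borel_measurable (\<mu> \<Otimes>\<^sub>M \<nu>)"
      using transfer_kernel_measurable[OF T] by (simp add: measurable_cong_sets[OF setsW refl])
    from measurable_compose[OF measurable_Pair2'[OF y] this]
    have m[measurable]: "(\<lambda>x. transfer_kernel k\<^sub>1 k\<^sub>2 T x y) \<in> borel_measurable \<mu>" by simp
    have sq: "(transfer_kernel k\<^sub>1 k\<^sub>2 T x y)\<^sup>2 \<le> G\<^sup>2" if "x \<in> space \<mu>" for x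
      using G[of x y] that y \<mu>(3) \<nu>(3) power_mono[of "\<bar>transfer_kernel k\<^sub>1 k\<^sub>2 T x y\<bar>" G 2] by simp
    have "integrable \<mu> (\<lambda>x. (transfer_kernel k\<^sub>1 k\<^sub>2 T x y)\<^sup>2)"
      by (rule M.integrable_const_bound[of _ "G\<^sup>2"]) (use sq in \<open>auto intro!: AE_I2\<close>)
    then show ?thesis using u m by (intro L2_funs_mult_integrable) (auto simp: L2_funs_def)
  qed
  show ?thesis
    unfolding S
  proof (rule hs_norm_le_of_kernel_bound[where s = ?s])
    show "(\<lambda>(x, y). ?s x y) \<in> borel_measurable (\<mu> \<Otimes>\<^sub>M \<nu>)"
      using transfer_kernel_measurable[OF Q] transfer_kernel_measurable[OF R]
      by (simp add: measurable_cong_sets[OF setsW refl] case_prod_beta')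
    show "\<bar>?s x y\<bar> \<le> S" if "x \<in> space \<mu>" "y \<in> space \<nu>" for x y
    proof -
      have "(\<lambda>(x, y). ennreal \<bar>?s x y\<bar>) (x, y) \<le> sup_norm X ?s"
        unfolding sup_norm_def by (rule SUP_upper) (use that \<mu> \<nu> in auto)
      then show ?thesis unfolding S by (simp add: S_def)
    qed
    show "op_diff (kernel_op \<mu> (transfer_kernel k\<^sub>1 k\<^sub>2 Q)) (kernel_op \<mu> (transfer_kernel k\<^sub>1 k\<^sub>2 R)) u y
        = (\<integral>x. u x * ?s x y \<partial>\<mu>)" if "u \<in> L2_funs \<mu>" "y \<in> space \<nu>" for u y
      using prod[OF Q that] prod[OF R that] by (simp add: op_diff_def kernel_op_def right_diff_distrib)
  qed (rule \<mu>(1) \<nu>(1))+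
qed simp

end

section \<open>Uniform deviation of the empirical transfer kernel\<close>

context kernel_pair
begin

lemma empirical_measurable:
  assumes z: "\<And>i. i < N \<Longrightarrow> z i \<in> X \<times> X"
  shows "z \<in> measurable (uniform_count_measure {..<N}) W"
  using z space_W
  by (simp add: measurable_cong_sets[OF sets_uniform_count_measure_count_space refl] Pi_iff)

lemma empirical_prob_space:
  assumes z: "\<And>i. i < N \<Longrightarrow> z i \<in> X \<times> X" and N: "0 < N"
  shows "prob_space (empirical X N z)" "sets (empirical X N z) = sets W"
proof -
  interpret U: prob_space "uniform_count_measure {..<N}"
    using N by (intro prob_space_uniform_count_measure) auto
  show "prob_space (empirical X N z)"
    unfolding empirical_def by (intro U.prob_space_distr empirical_measurable z)
  show "sets (empirical X N z) = sets W" by (simp add: empirical_def)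
qed

lemma transfer_kernel_empirical:
  assumes z: "\<And>i. i < N \<Longrightarrow> z i \<in> X \<times> X" and "x \<in> X" "y \<in> X"
  shows "transfer_kernel k\<^sub>1 k\<^sub>2 (empirical X N z) x y
    = (\<Sum>i<N. k\<^sub>1 x (fst (z i)) * k\<^sub>2 (snd (z i)) y) / real N"
  unfolding transfer_kernel_def empirical_def
  by (subst integral_distr[OF empirical_measurable[OF z] integrand_measurable])
     (simp_all add: assms integral_uniform_count_measure case_prod_beta)


text \<open>
  The bounds are required at the sample points only, which makes the constant independent of the
  size of the kernels off the supports.
\<close>

lemma transfer_kernel_empirical_lipschitz:
  assumes z: "\<And>i. i < N \<Longrightarrow> z i \<in> X \<times> X" and N: "0 < N"
    and X: "x \<in> X" "y \<in> X" "p \<in> X" "q \<in> X"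
    and b: "\<And>i x. i < N \<Longrightarrow> x \<in> X \<Longrightarrow> k\<^sub>1 x (fst (z i)) \<le> b\<^sub>1" "\<And>i y. i < N \<Longrightarrow> y \<in> X \<Longrightarrow> k\<^sub>2 (snd (z i)) y \<le> b\<^sub>2"
  shows "\<bar>transfer_kernel k\<^sub>1 k\<^sub>2 (empirical X N z) x y - transfer_kernel k\<^sub>1 k\<^sub>2 (empirical X N z) p q\<bar>
    \<le> b\<^sub>1 * b\<^sub>2 * (2 * L / \<epsilon>) * (edist d x p + edist d y q)" (is "_ \<le> ?K")
proof -
  let ?f = "\<lambda>x y i. k\<^sub>1 x (fst (z i)) * k\<^sub>2 (snd (z i)) y"
  have "\<bar>(\<Sum>i<N. ?f x y i) - (\<Sum>i<N. ?f p q i)\<bar> \<le> (\<Sum>i<N. \<bar>?f x y i - ?f p q i\<bar>)"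
    by (simp add: sum_subtractf[symmetric])
  also have "\<dots> \<le> (\<Sum>i<N. ?K)"
    using z b by (intro sum_mono integrand_lipschitz X) auto
  finally have "\<bar>(\<Sum>i<N. ?f x y i) - (\<Sum>i<N. ?f p q i)\<bar> / real N \<le> ?K"
    using N by (simp add: field_simps)
  then show ?thesis
    using N by (simp add: transfer_kernel_empirical[OF z] X abs_divide flip: diff_divide_distrib)
qed

text \<open>
  By continuity the event does not change if \<open>x\<close> and \<open>y\<close> are restricted to a countable dense set.
  Continuity must hold for every sample, including the null set of those that leave the supports;
  hence the bounds \<open>G\<^sub>1\<close> and \<open>G\<^sub>2\<close>, which come from compactness and hold on all of \<open>X \<times> X\<close>.
\<close>

lemma deviation_event_measurable:
  assumes \<pi>: "prob_space \<pi>" "sets \<pi> = sets W" and N: "0 < N" and d: "0 < d"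
  defines "P \<equiv> PiM {..<N} (\<lambda>_. \<pi>)"
  shows "{z \<in> space P. \<forall>x\<in>X. \<forall>y\<in>X. \<bar>transfer_kernel k\<^sub>1 k\<^sub>2 (empirical X N z) x y - transfer_kernel k\<^sub>1 k\<^sub>2 \<pi> x y\<bar> \<le> R}
    \<in> sets P"
proof -
  let ?D = "\<lambda>z x y. \<bar>transfer_kernel k\<^sub>1 k\<^sub>2 (empirical X N z) x y - transfer_kernel k\<^sub>1 k\<^sub>2 \<pi> x y\<bar>"
  let ?A = "\<lambda>z x y. \<bar>(\<Sum>i<N. k\<^sub>1 x (fst (z i)) * k\<^sub>2 (snd (z i)) y) / real N - transfer_kernel k\<^sub>1 k\<^sub>2 \<pi> x y\<bar>"
  have sp: "space \<pi> = X \<times> X" using sets_eq_imp_space_eq[OF \<pi>(2)] space_W by simp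
  have zX: "z i \<in> X \<times> X" if "z \<in> space P" "i < N" for z i
    using that sp by (auto simp: P_def space_PiM PiE_iff)
  obtain Q where Q: "countable Q" "Q \<subseteq> X" "\<And>x r. x \<in> X \<Longrightarrow> 0 < r \<Longrightarrow> \<exists>p\<in>Q. edist d x p < r"
    using countable_edist_dense[OF K1.compact d] by metis
  obtain G\<^sub>1 where G1: "\<And>x y. x \<in> X \<Longrightarrow> y \<in> X \<Longrightarrow> k\<^sub>1 x y \<le> G\<^sub>1" using K1.kernel_bounded by blast
  obtain G\<^sub>2 where G2: "\<And>x y. x \<in> X \<Longrightarrow> y \<in> X \<Longrightarrow> k\<^sub>2 x y \<le> G\<^sub>2" using K2.kernel_bounded by blast
  define \<Lambda> where "\<Lambda> = \<bar>G\<^sub>1 * G\<^sub>2 * (2 * L / \<epsilon>)\<bar>"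
  have \<Lambda>: "G\<^sub>1 * G\<^sub>2 * (2 * L / \<epsilon>) \<le> \<Lambda>" unfolding \<Lambda>_def by (rule abs_ge_self)
  have iff: "(\<forall>x\<in>X. \<forall>y\<in>X. ?D z x y \<le> R) = (\<forall>x\<in>Q. \<forall>y\<in>Q. ?A z x y \<le> R)"
    if z: "z \<in> space P" for z
  proof -
    have zX': "\<And>i. i < N \<Longrightarrow> z i \<in> X \<times> X" using zX[OF z] .
    have DA: "?D z x y = ?A z x y" if "x \<in> X" "y \<in> X" for x y
      by (simp only: transfer_kernel_empirical[OF zX' that])
    show "(\<forall>x\<in>X. \<forall>y\<in>X. ?D z x y \<le> R) = (\<forall>x\<in>Q. \<forall>y\<in>Q. ?A z x y \<le> R)"
    proof
      assume all: "\<forall>x\<in>X. \<forall>y\<in>X. ?D z x y \<le> R"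
      show "\<forall>x\<in>Q. \<forall>y\<in>Q. ?A z x y \<le> R"
      proof (intro ballI)
        fix x y assume "x \<in> Q" "y \<in> Q"
        then have X: "x \<in> X" "y \<in> X" using Q(2) by auto
        then have "?D z x y \<le> R" using all by blast
        then show "?A z x y \<le> R" by (simp only: DA[OF X])
      qed
    next
      assume q: "\<forall>x\<in>Q. \<forall>y\<in>Q. ?A z x y \<le> R"
      show "\<forall>x\<in>X. \<forall>y\<in>X. ?D z x y \<le> R"
      proof (intro ballI, rule field_le_epsilon)
        fix x y and e :: real assume X: "x \<in> X" "y \<in> X" and e: "0 < e"
        define r where "r = (e / 4) / (\<Lambda> + 1)"
        have "0 \<le> \<Lambda>" by (simp add: \<Lambda>_def)
        then have r: "0 < r" using e by (simp add: r_def)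
        obtain p where p: "p \<in> Q" "edist d x p < r" using Q(3)[OF X(1) r] by auto
        obtain q' where q': "q' \<in> Q" "edist d y q' < r" using Q(3)[OF X(2) r] by auto
        have pX: "p \<in> X" "q' \<in> X" using p q' Q(2) by auto
        let ?t = "transfer_kernel k\<^sub>1 k\<^sub>2 \<pi>" and ?tN = "transfer_kernel k\<^sub>1 k\<^sub>2 (empirical X N z)"
        let ?E = "edist d x p + edist d y q'"
        have E: "0 \<le> ?E" "?E \<le> 2 * r" using p q' by auto
        have "\<bar>?tN x y - ?tN p q'\<bar> \<le> G\<^sub>1 * G\<^sub>2 * (2 * L / \<epsilon>) * ?E"
          using zX' G1 G2 by (intro transfer_kernel_empirical_lipschitz zX' N X pX) (auto simp: mem_Times_iff)
        also have "\<dots> \<le> \<Lambda> * ?E" using \<Lambda> E(1) by (rule mult_right_mono)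
        finally have 1: "\<bar>?tN x y - ?tN p q'\<bar> \<le> \<Lambda> * ?E" .
        have "AE w in \<pi>. (\<forall>x\<in>X. k\<^sub>1 x (fst w) \<le> G\<^sub>1) \<and> (\<forall>y\<in>X. k\<^sub>2 (snd w) y \<le> G\<^sub>2)"
          using G1 G2 sp by (intro AE_I2) (auto simp: mem_Times_iff)
        then have "\<bar>?t x y - ?t p q'\<bar> \<le> G\<^sub>1 * G\<^sub>2 * (2 * L / \<epsilon>) * ?E"
          by (intro transfer_kernel_lipschitz \<pi> X pX)
        also have "\<dots> \<le> \<Lambda> * ?E" using \<Lambda> E(1) by (rule mult_right_mono)
        finally have 2: "\<bar>?t x y - ?t p q'\<bar> \<le> \<Lambda> * ?E" .
        have "?A z p q' \<le> R" using q p(1) q'(1) by blast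
        then have 3: "\<bar>?tN p q' - ?t p q'\<bar> \<le> R" by (simp only: DA[OF pX])
        have "\<Lambda> * ?E \<le> (\<Lambda> + 1) * (2 * r)"
          using E \<open>0 \<le> \<Lambda>\<close> by (intro mult_mono) auto
        also have "\<dots> = 2 * (r * (\<Lambda> + 1))" by simp
        also have "r * (\<Lambda> + 1) = e / 4"
          by (rule nonzero_eq_divide_eq[THEN iffD1, OF _ r_def]) (use \<open>0 \<le> \<Lambda>\<close> in linarith)
        also have "2 * (e / 4) = e / 2" by simp
        finally have "\<Lambda> * ?E \<le> e / 2" .
        then show "?D z x y \<le> R + e" using 1 2 3 by linarith
      qed
    qed
  qed
  have "{z \<in> space P. \<forall>x\<in>Q. \<forall>y\<in>Q. ?A z x y \<le> R} \<in> sets P"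
  proof (rule sets.sets_Collect_countable_All'[OF _ Q(1)], rule sets.sets_Collect_countable_All'[OF _ Q(1)])
    fix x y assume "x \<in> Q" "y \<in> Q"
    then have X: "x \<in> X" "y \<in> X" using Q(2) by auto
    have f: "(\<lambda>w. k\<^sub>1 x (fst w) * k\<^sub>2 (snd w) y) \<in> borel_measurable \<pi>"
      using integrand_measurable[OF X] by (simp add: measurable_cong_sets[OF \<pi>(2) refl] case_prod_beta')
    have "(\<lambda>z. k\<^sub>1 x (fst (z i)) * k\<^sub>2 (snd (z i)) y) \<in> borel_measurable P" if "i < N" for i
      unfolding P_def using that
      by (intro measurable_compose[OF measurable_component_singleton[of i "{..<N}" "\<lambda>_. \<pi>"] f]) simp
    then have [measurable]: "(\<lambda>z. \<Sum>i<N. k\<^sub>1 x (fst (z i)) * k\<^sub>2 (snd (z i)) y) \<in> borel_measurable P"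
      by (intro borel_measurable_sum) auto
    show "{z \<in> space P. ?A z x y \<le> R} \<in> sets P" by measurable
  qed
  also have "{z \<in> space P. \<forall>x\<in>Q. \<forall>y\<in>Q. ?A z x y \<le> R} = {z \<in> space P. \<forall>x\<in>X. \<forall>y\<in>X. ?D z x y \<le> R}"
    using iff by blast
  finally show ?thesis .
qed

text \<open>
  Hoeffding's inequality on the net \<open>Y \<times> Y\<close> contributes \<open>s\<close>. Passing from \<open>(x, y)\<close> to a net point
  at distance \<open>r\<close> in each variable changes the empirical and the true kernel by at most
  \<open>b\<^sub>1 * b\<^sub>2 * (2 * L / \<epsilon>) * (2 * r)\<close> each.
\<close>

theorem uniform_deviation:
  assumes \<pi>: "coupling X \<mu> \<nu> \<pi>" and N: "0 < N" and d: "0 < d"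
    and b: "0 < b\<^sub>1" "0 < b\<^sub>2"
      "\<And>x x'. x \<in> X \<Longrightarrow> x' \<in> spt d X \<mu> \<Longrightarrow> k\<^sub>1 x x' \<le> b\<^sub>1"
      "\<And>y' y. y' \<in> spt d X \<nu> \<Longrightarrow> y \<in> X \<Longrightarrow> k\<^sub>2 y' y \<le> b\<^sub>2"
    and Y: "finite Y" "Y \<subseteq> X" "\<And>x. x \<in> X \<Longrightarrow> \<exists>p\<in>Y. edist d x p \<le> r"
    and s: "0 \<le> s"
    and R: "s + 4 * (b\<^sub>1 * b\<^sub>2 * (2 * L / \<epsilon>)) * r \<le> R"
  defines "P \<equiv> PiM {..<N} (\<lambda>_. \<pi>)"
  shows "1 - 2 * real (card Y) ^ 2 * exp (- 2 * real N * s\<^sup>2 / (b\<^sub>1 * b\<^sub>2)\<^sup>2)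
    \<le> measure P {z \<in> space P. \<forall>x\<in>X. \<forall>y\<in>X.
        \<bar>transfer_kernel k\<^sub>1 k\<^sub>2 (empirical X N z) x y - transfer_kernel k\<^sub>1 k\<^sub>2 \<pi> x y\<bar> \<le> R}"
proof -
  have \<pi>p: "prob_space \<pi>" and \<pi>s: "sets \<pi> = sets W"
    and m: "distr \<pi> (borel_on X) fst = \<mu>" "distr \<pi> (borel_on X) snd = \<nu>"
    using \<pi> by (auto simp: coupling_def)
  interpret \<pi>: prob_space \<pi> by (rule \<pi>p)
  interpret P: prob_space P unfolding P_def by (intro prob_space_PiM) (rule \<pi>p)
  have sp: "space \<pi> = X \<times> X" using sets_eq_imp_space_eq[OF \<pi>s] space_W by simp
  have zX: "z i \<in> X \<times> X" if "z \<in> space P" "i < N" for z i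
    using that sp by (auto simp: P_def space_PiM PiE_iff)
  have fm: "fst \<in> measurable \<pi> (borel_on X)" and sm: "snd \<in> measurable \<pi> (borel_on X)"
    by (simp_all add: measurable_cong_sets[OF \<pi>s refl])
  have "AE w in \<pi>. fst w \<in> spt d X \<mu>"
    using AE_in_spt[OF K1.\<rho> K1.compact d] by (rule AE_distrD[OF fm, unfolded m(1)])
  moreover have "AE w in \<pi>. snd w \<in> spt d X \<nu>"
    using AE_in_spt[OF K2.\<rho> K2.compact d] by (rule AE_distrD[OF sm, unfolded m(2)])
  ultimately have AEb: "AE w in \<pi>. (\<forall>x\<in>X. k\<^sub>1 x (fst w) \<le> b\<^sub>1) \<and> (\<forall>y\<in>X. k\<^sub>2 (snd w) y \<le> b\<^sub>2)"
    by eventually_elim (auto intro: b)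
  have AEz: "AE z in P. \<forall>i<N. (\<forall>x\<in>X. k\<^sub>1 x (fst (z i)) \<le> b\<^sub>1) \<and> (\<forall>y\<in>X. k\<^sub>2 (snd (z i)) y \<le> b\<^sub>2)"
  proof -
    have "AE z in P. \<forall>i\<in>{..<N}. (\<forall>x\<in>X. k\<^sub>1 x (fst (z i)) \<le> b\<^sub>1) \<and> (\<forall>y\<in>X. k\<^sub>2 (snd (z i)) y \<le> b\<^sub>2)"
    proof (rule AE_finite_allI)
      fix i assume "i \<in> {..<N}"
      with AEb \<pi>p show "AE z in P. (\<forall>x\<in>X. k\<^sub>1 x (fst (z i)) \<le> b\<^sub>1) \<and> (\<forall>y\<in>X. k\<^sub>2 (snd (z i)) y \<le> b\<^sub>2)"
        unfolding P_def
        by (intro AE_PiM_component[where P = "\<lambda>w. (\<forall>x\<in>X. k\<^sub>1 x (fst w) \<le> b\<^sub>1) \<and> (\<forall>y\<in>X. k\<^sub>2 (snd w) y \<le> b\<^sub>2)"])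
    qed simp
    then show ?thesis by eventually_elim simp
  qed
  let ?f = "\<lambda>(x, y) w. k\<^sub>1 x (fst w) * k\<^sub>2 (snd w) y"
  let ?G = "{z \<in> space P. \<forall>\<theta>\<in>Y \<times> Y. \<bar>(\<Sum>i<N. ?f \<theta> (z i)) / real N - (\<integral>w. ?f \<theta> w \<partial>\<pi>)\<bar> \<le> s}"
  let ?T = "{z \<in> space P. \<forall>x\<in>X. \<forall>y\<in>X.
        \<bar>transfer_kernel k\<^sub>1 k\<^sub>2 (empirical X N z) x y - transfer_kernel k\<^sub>1 k\<^sub>2 \<pi> x y\<bar> \<le> R}"
  have fmeas: "?f \<theta> \<in> borel_measurable \<pi>" if "\<theta> \<in> Y \<times> Y" for \<theta>
  proof -
    obtain x y where \<theta>: "\<theta> = (x, y)" by (cases \<theta>)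
    then have "x \<in> X" "y \<in> X" using that Y(2) by auto
    from integrand_measurable[OF this] show ?thesis
      by (simp add: \<theta> measurable_cong_sets[OF \<pi>s refl] case_prod_beta')
  qed
  have fb: "AE w in \<pi>. ?f \<theta> w \<in> {0..b\<^sub>1 * b\<^sub>2}" if "\<theta> \<in> Y \<times> Y" for \<theta>
    using AEb AE_space
  proof eventually_elim
    case (elim w)
    obtain x y where \<theta>: "\<theta> = (x, y)" by (cases \<theta>)
    then have X: "x \<in> X" "y \<in> X" using that Y(2) by auto
    show ?case using integrand_bounds[OF X, of w b\<^sub>1 b\<^sub>2] elim X sp by (auto simp: \<theta>)
  qed
  have finYY: "finite (Y \<times> Y)" using Y by simp
  have "1 - 2 * real (card (Y \<times> Y)) * exp (- 2 * real N * s\<^sup>2 / (b\<^sub>1 * b\<^sub>2)\<^sup>2) \<le> measure P ?G"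
    unfolding P_def
    by (rule \<pi>.uniform_Hoeffding(2)[OF finYY fmeas fb _ N s]) (use b in auto)
  also have "\<dots> \<le> measure P ?T"
  proof (rule P.finite_measure_mono_AE)
    show "?T \<in> sets P" unfolding P_def by (rule deviation_event_measurable[OF \<pi>p \<pi>s N d])
    show "AE z in P. z \<in> ?G \<longrightarrow> z \<in> ?T"
      using AEz
    proof (eventually_elim, safe)
      fix z x y
      assume zb: "\<forall>i<N. (\<forall>x\<in>X. k\<^sub>1 x (fst (z i)) \<le> b\<^sub>1) \<and> (\<forall>y\<in>X. k\<^sub>2 (snd (z i)) y \<le> b\<^sub>2)"
        and z: "z \<in> space P"
        and good: "\<forall>\<theta>\<in>Y \<times> Y. \<bar>(\<Sum>i<N. ?f \<theta> (z i)) / real N - (\<integral>w. ?f \<theta> w \<partial>\<pi>)\<bar> \<le> s"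
        and X: "x \<in> X" "y \<in> X"
      let ?t = "transfer_kernel k\<^sub>1 k\<^sub>2 \<pi>" and ?tN = "transfer_kernel k\<^sub>1 k\<^sub>2 (empirical X N z)"
      obtain p q where pq: "p \<in> Y" "edist d x p \<le> r" "q \<in> Y" "edist d y q \<le> r" using Y(3) X by metis
      then have pX: "p \<in> X" "q \<in> X" using Y(2) by auto
      let ?K = "b\<^sub>1 * b\<^sub>2 * (2 * L / \<epsilon>)" and ?E = "edist d x p + edist d y q"
      have "0 \<le> ?K" using b K1.L_pos K1.eps by simp
      define e where "e = ?K * (2 * r)"
      have KE: "?K * ?E \<le> e" unfolding e_def using \<open>0 \<le> ?K\<close> pq by (intro mult_left_mono) auto
      have eR: "s + 2 * e \<le> R" using R by (simp add: e_def mult_ac)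
      have 1: "\<bar>?tN x y - ?tN p q\<bar> \<le> ?K * ?E"
        using zb by (intro transfer_kernel_empirical_lipschitz zX[OF z] N X pX) auto
      have 2: "\<bar>?t x y - ?t p q\<bar> \<le> ?K * ?E"
        by (intro transfer_kernel_lipschitz \<pi>p \<pi>s X pX AEb)
      have "(p, q) \<in> Y \<times> Y" using pq by simp
      from bspec[OF good this] have "\<bar>(\<Sum>i<N. ?f (p, q) (z i)) / real N - ?t p q\<bar> \<le> s"
        by (simp add: transfer_kernel_def case_prod_beta')
      then have 3: "\<bar>?tN p q - ?t p q\<bar> \<le> s"
        by (simp add: transfer_kernel_empirical[OF zX[OF z] pX])
      show "\<bar>?tN x y - ?t x y\<bar> \<le> R"
        using order_trans[OF 1 KE] order_trans[OF 2 KE] 3 eR by linarith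
    qed
  qed
  finally show ?thesis by (simp add: card_cartesian_product power2_eq_square)
qed

end

section \<open>The choice of constants\<close>

text \<open>
  The union bound runs over \<open>n\<^sup>2\<close> net points, with \<open>ln n\<close> at most \<open>d (4 + ln \<Delta> + ln N / 2)\<close>. Write
  \<open>A\<close> for the logarithm of \<open>4 \<surd>2 \<Delta> / \<tau>\<close>. The quantities \<open>ln \<Delta>\<close>, \<open>ln (2 / \<tau>)\<close>, \<open>ln N\<close> and 1 are all
  at most \<open>A ln N\<close>, since \<open>A\<close> and \<open>ln N\<close> are at least 1 (this uses \<open>N \<ge> 3 > e\<close>). Collecting the
  terms gives the factor \<open>12 = 1 + 8 + 2 + 1\<close>.
\<close>

lemma entropy_beaten_by_exponent:
  fixes d N :: nat and \<Delta> \<tau> :: real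
  assumes d: "0 < d" and N: "3 \<le> N" and \<Delta>: "1 \<le> \<Delta>" and \<tau>: "0 < \<tau>" "\<tau> < 1"
    and n: "0 \<le> n" "n \<le> (2 * exp 1 * (2 + \<Delta> * sqrt N)) ^ d"
  shows "2 * n\<^sup>2 * exp (- 12 * (real d * ln N * ln (4 * sqrt 2 * \<Delta> / \<tau>))) \<le> \<tau>"
proof -
  define l where "l = ln (real N)"
  define A where "A = ln (4 * sqrt 2 * \<Delta> / \<tau>)"
  have e3: "exp 1 \<le> (3::real)" by (rule exp_le)
  have l: "1 \<le> l"
    using N e3 by (simp add: l_def ln_ge_iff)
  have expA: "exp A = 4 * sqrt 2 * \<Delta> / \<tau>" using \<Delta> \<tau> by (simp add: A_def)
  have s2: "1 \<le> sqrt 2" by simp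
  have big: "\<Delta> * 4 \<le> exp A"
  proof -
    have "\<Delta> * 4 \<le> 4 * sqrt 2 * \<Delta>" using s2 \<Delta> by simp
    also have "\<dots> \<le> 4 * sqrt 2 * \<Delta> / \<tau>" using \<tau> \<Delta> by (simp add: field_simps mult_left_le)
    finally show ?thesis using expA by simp
  qed
  have A: "1 \<le> A"
  proof -
    have "exp 1 \<le> exp A" using big e3 \<Delta> by linarith
    then show ?thesis by simp
  qed
  have ln\<Delta>: "ln \<Delta> \<le> A" "0 \<le> ln \<Delta>"
  proof -
    have "\<Delta> \<le> exp A" using big \<Delta> by linarith
    then have "ln \<Delta> \<le> ln (exp A)" using \<Delta> by (subst ln_le_cancel_iff) auto
    then show "ln \<Delta> \<le> A" by simp
  qed (use \<Delta> in simp)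
  have two: "2 \<le> \<tau> * exp A"
  proof -
    have "1 * 1 \<le> sqrt 2 * \<Delta>" using s2 \<Delta> by (intro mult_mono) auto
    then have "2 \<le> 4 * (sqrt 2 * \<Delta>)" by linarith
    also have "\<dots> = \<tau> * exp A" using \<tau> by (simp add: expA)
    finally show ?thesis .
  qed
  have sN: "1 \<le> sqrt N" using N by simp
  have "1 * 1 \<le> \<Delta> * sqrt N" using \<Delta> sN by (intro mult_mono) auto
  then have "2 * exp 1 * (2 + \<Delta> * sqrt N) \<le> 2 * exp 1 * (3 * (\<Delta> * sqrt N))"
    by (intro mult_left_mono) auto
  also have "\<dots> = 6 * exp 1 * (\<Delta> * sqrt N)" by simp
  also have "\<dots> \<le> exp 3 * exp 1 * (\<Delta> * sqrt N)"
  proof -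
    have "(2::real) \<le> exp 1" using exp_ge_add_one_self[of "1::real"] by simp
    then have "(2::real) ^ 3 \<le> exp 1 ^ 3" by (rule power_mono) simp
    then have "(6::real) \<le> exp 3" by (simp flip: exp_of_nat_mult)
    then show ?thesis using \<Delta> by (intro mult_right_mono) auto
  qed
  also have "\<dots> = exp (4 + ln \<Delta> + l / 2)"
  proof -
    have "sqrt N = exp (l / 2)"
      using N by (simp add: l_def ln_sqrt[symmetric])
    then show ?thesis using \<Delta> by (simp add: exp_add flip: mult.assoc)
        (simp flip: exp_add)
  qed
  finally have base: "2 * exp 1 * (2 + \<Delta> * sqrt N) \<le> exp (4 + ln \<Delta> + l / 2)" .
  have "n \<le> exp (4 + ln \<Delta> + l / 2) ^ d"
    using n(2) power_mono[OF base, of d] \<Delta> by (auto intro: order_trans)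
  also have "\<dots> = exp (real d * (4 + ln \<Delta> + l / 2))" by (simp flip: exp_of_nat_mult)
  finally have "n\<^sup>2 \<le> (exp (real d * (4 + ln \<Delta> + l / 2)))\<^sup>2" using n(1) by (rule power_mono)
  also have "\<dots> = exp (real d * (8 + 2 * ln \<Delta> + l))"
    by (simp flip: exp_of_nat_mult add: algebra_simps)
  finally have n2: "n\<^sup>2 \<le> exp (real d * (8 + 2 * ln \<Delta> + l))" .
  have "1 * 1 \<le> l * A" using l A by (intro mult_mono) auto
  moreover have "1 * A \<le> l * A" "l * 1 \<le> l * A" using l A by (intro mult_mono; simp)+
  ultimately have "8 + 2 * ln \<Delta> + l \<le> 11 * (l * A)" using ln\<Delta> by linarith
  then have 1: "real d * (8 + 2 * ln \<Delta> + l) \<le> real d * (11 * (l * A))" by (intro mult_left_mono) auto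
  have "1 * (l * A) \<le> real d * (l * A)" using d l A by (intro mult_right_mono) auto
  with \<open>1 * A \<le> l * A\<close> 1 have ex: "A + real d * (8 + 2 * ln \<Delta> + l) - 12 * (real d * l * A) \<le> 0"
    by (simp add: algebra_simps)
  have "2 * n\<^sup>2 * exp (- 12 * (real d * l * A))
      \<le> (\<tau> * exp A) * exp (real d * (8 + 2 * ln \<Delta> + l)) * exp (- 12 * (real d * l * A))"
    using two n2 by (intro mult_right_mono mult_mono) auto
  also have "\<dots> = \<tau> * exp (A + real d * (8 + 2 * ln \<Delta> + l) - 12 * (real d * l * A))"
    by (simp add: exp_diff exp_add exp_minus field_simps)
  also have "\<dots> \<le> \<tau> * 1" using ex \<tau> by (intro mult_left_mono) auto
  finally show ?thesis by (simp add: l_def A_def)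
qed

lemma eot_kernel_imp_schroedinger_kernel:
  assumes "is_eot_kernel X c \<epsilon> \<rho> \<sigma> k" "compactin (Euclidean_space d) X" "lipschitz_cost d X c L"
    "0 < \<epsilon>" "borel_prob X \<rho>" "borel_prob X \<sigma>"
  obtains \<alpha> \<beta> where "schroedinger_kernel d X c L \<epsilon> \<rho> \<sigma> \<alpha> \<beta> k"
proof -
  obtain \<alpha> \<beta> where ab: "eot_potentials X c \<epsilon> \<rho> \<sigma> \<alpha> \<beta>"
    "\<forall>x\<in>X. \<forall>y\<in>X. k x y = exp ((\<alpha> x + \<beta> y - c x y) / \<epsilon>)"
    using assms(1) unfolding is_eot_kernel_def by blast
  have "schroedinger_kernel d X c L \<epsilon> \<rho> \<sigma> \<alpha> \<beta> k"
  proof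
    show "compact X" using assms(2) by (rule compact_of_Euclidean_space)
  qed (use ab assms in \<open>auto simp: eot_potentials_def\<close>)
  then show ?thesis by (rule that)
qed

theorem theorem2p22:
  fixes C\<^sub>\<mu> C\<^sub>\<nu> L :: real
  shows "\<exists>M>0.
    \<forall>(d::nat) (X::point set) (c::point \<Rightarrow> point \<Rightarrow> real) (\<mu>::point measure) (\<nu>::point measure)
      (D\<^sub>\<mu>::real) (\<delta>\<^sub>\<mu>::real) (D\<^sub>\<nu>::real) (\<delta>\<^sub>\<nu>::real) (\<pi>::(point \<times> point) measure)
      (\<tau>::real) (\<epsilon>::real) (N::nat) (k\<^sub>\<mu>::point \<Rightarrow> point \<Rightarrow> real) (k\<^sub>\<nu>::point \<Rightarrow> point \<Rightarrow> real).
      compactin (Euclidean_space d) X \<and> ediam d X \<ge> 1 \<and>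
      lipschitz_cost d X c L \<and>
      borel_prob X \<mu> \<and> borel_prob X \<nu> \<and>
      ball_mass d X \<mu> C\<^sub>\<mu> D\<^sub>\<mu> \<delta>\<^sub>\<mu> \<and> ball_mass d X \<nu> C\<^sub>\<nu> D\<^sub>\<nu> \<delta>\<^sub>\<nu> \<and>
      coupling X \<mu> \<nu> \<pi> \<and>
      0 < \<tau> \<and> \<tau> < 1 \<and> 0 < \<epsilon> \<and> \<epsilon> \<le> 1 \<and> N \<ge> 3 \<and>
      is_eot_kernel X c \<epsilon> \<mu> \<mu> k\<^sub>\<mu> \<and> is_eot_kernel X c \<epsilon> \<nu> \<nu> k\<^sub>\<nu>
      \<longrightarrow>
      (let t = transfer_kernel k\<^sub>\<mu> k\<^sub>\<nu> \<pi>;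
           t\<^sub>N = (\<lambda>z. transfer_kernel k\<^sub>\<mu> k\<^sub>\<nu> (empirical X N z));
           P = PiM {..<N} (\<lambda>_. \<pi>)
       in measure P {z \<in> space P.
            hs_norm \<mu> \<nu> (op_diff (kernel_op \<mu> (t\<^sub>N z)) (kernel_op \<mu> t))
              \<le> sup_norm X (\<lambda>x y. t\<^sub>N z x y - t x y) \<and>
            sup_norm X (\<lambda>x y. t\<^sub>N z x y - t x y)
              \<le> ennreal (M
                  * (scale_factor D\<^sub>\<mu> \<delta>\<^sub>\<mu> \<epsilon> * scale_factor D\<^sub>\<nu> \<delta>\<^sub>\<nu> \<epsilon>)
                  * (sqrt (2 * real d) / \<epsilon> powr (1 + D\<^sub>\<mu> + D\<^sub>\<nu>))
                  * sqrt (ln (real N) / real N)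
                  * sqrt (ln (4 * sqrt 2 * ediam d X / \<tau>)))}
          \<ge> 1 - \<tau>)"
proof -
  \<comment> \<open>If one of the constants is not positive, the hypotheses cannot hold, and any \<open>M\<close> will do.\<close>
  define M where "M = (if 0 < C\<^sub>\<mu> \<and> 0 < C\<^sub>\<nu> \<and> 0 < L
    then exp (2 * L) / C\<^sub>\<mu> * (exp (2 * L) / C\<^sub>\<nu>) * (2 + 8 * L) else 1)"
  have M: "0 < M" by (auto simp: M_def intro!: mult_pos_pos divide_pos_pos add_pos_pos)
  show ?thesis
  proof (intro exI[of _ M] conjI M allI impI, elim conjE)
    fix d :: nat and X :: "point set" and c :: "point \<Rightarrow> point \<Rightarrow> real" and \<mu> \<nu> :: "point measure"
      and D\<^sub>\<mu> \<delta>\<^sub>\<mu> D\<^sub>\<nu> \<delta>\<^sub>\<nu> :: real and \<pi> :: "(point \<times> point) measure" and \<tau> \<epsilon> :: real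
      and N :: nat and k\<^sub>\<mu> k\<^sub>\<nu> :: "point \<Rightarrow> point \<Rightarrow> real"
    assume X: "compactin (Euclidean_space d) X" and diam: "1 \<le> ediam d X"
      and c: "lipschitz_cost d X c L" and \<mu>: "borel_prob X \<mu>" and \<nu>: "borel_prob X \<nu>"
      and bm\<mu>: "ball_mass d X \<mu> C\<^sub>\<mu> D\<^sub>\<mu> \<delta>\<^sub>\<mu>" and bm\<nu>: "ball_mass d X \<nu> C\<^sub>\<nu> D\<^sub>\<nu> \<delta>\<^sub>\<nu>"
      and \<pi>: "coupling X \<mu> \<nu> \<pi>" and \<tau>: "0 < \<tau>" "\<tau> < 1" and \<epsilon>: "0 < \<epsilon>" "\<epsilon> \<le> 1" and N: "3 \<le> N"
      and k\<mu>: "is_eot_kernel X c \<epsilon> \<mu> \<mu> k\<^sub>\<mu>" and k\<nu>: "is_eot_kernel X c \<epsilon> \<nu> \<nu> k\<^sub>\<nu>"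
    obtain \<alpha>\<^sub>1 \<beta>\<^sub>1 where s1: "schroedinger_kernel d X c L \<epsilon> \<mu> \<mu> \<alpha>\<^sub>1 \<beta>\<^sub>1 k\<^sub>\<mu>"
      using eot_kernel_imp_schroedinger_kernel[OF k\<mu> X c \<epsilon>(1) \<mu> \<mu>] .
    obtain \<alpha>\<^sub>2 \<beta>\<^sub>2 where s2: "schroedinger_kernel d X c L \<epsilon> \<nu> \<nu> \<alpha>\<^sub>2 \<beta>\<^sub>2 k\<^sub>\<nu>"
      using eot_kernel_imp_schroedinger_kernel[OF k\<nu> X c \<epsilon>(1) \<nu> \<nu>] .
    interpret kernel_pair d X c L \<epsilon> \<mu> \<nu> \<alpha>\<^sub>1 \<beta>\<^sub>1 k\<^sub>\<mu> \<alpha>\<^sub>2 \<beta>\<^sub>2 k\<^sub>\<nu>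
      using s1 s2 by (simp add: kernel_pair_def)
    interpret S2: schroedinger_kernel d X c L \<epsilon> \<nu> \<nu> \<beta>\<^sub>2 \<alpha>\<^sub>2 "\<lambda>x y. k\<^sub>\<nu> y x" by (rule K2.swap)
    let ?t = "transfer_kernel k\<^sub>\<mu> k\<^sub>\<nu> \<pi>" and ?tN = "\<lambda>z. transfer_kernel k\<^sub>\<mu> k\<^sub>\<nu> (empirical X N z)"
    define P where "P = PiM {..<N} (\<lambda>_. \<pi>)"
    define l where "l = ln (real N)"
    define A where "A = ln (4 * sqrt 2 * ediam d X / \<tau>)"
    define f\<^sub>\<mu> where "f\<^sub>\<mu> = scale_factor D\<^sub>\<mu> \<delta>\<^sub>\<mu> \<epsilon>"
    define f\<^sub>\<nu> where "f\<^sub>\<nu> = scale_factor D\<^sub>\<nu> \<delta>\<^sub>\<nu> \<epsilon>"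
    have C: "0 < C\<^sub>\<mu>" "0 < C\<^sub>\<nu>" and d: "0 < d" using bm\<mu> bm\<nu> by (auto simp: ball_mass_def)
    have L: "0 < L" by (rule K1.L_pos)
    have f: "0 < f\<^sub>\<mu>" "0 < f\<^sub>\<nu>" by (simp_all add: f\<^sub>\<mu>_def f\<^sub>\<nu>_def scale_factor_def)
    define b\<^sub>\<mu> where "b\<^sub>\<mu> = exp (2 * L) / C\<^sub>\<mu> * (f\<^sub>\<mu> / \<epsilon> powr D\<^sub>\<mu>)"
    define b\<^sub>\<nu> where "b\<^sub>\<nu> = exp (2 * L) / C\<^sub>\<nu> * (f\<^sub>\<nu> / \<epsilon> powr D\<^sub>\<nu>)"
    have b: "0 < b\<^sub>\<mu>" "0 < b\<^sub>\<nu>" using C f \<epsilon> by (auto simp: b\<^sub>\<mu>_def b\<^sub>\<nu>_def)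
    define B where "B = b\<^sub>\<mu> * b\<^sub>\<nu>"
    have B: "0 < B" using b by (simp add: B_def)
    have k\<mu>b: "k\<^sub>\<mu> x x' \<le> b\<^sub>\<mu>" if "x \<in> X" "x' \<in> spt d X \<mu>" for x x'
      using K1.kernel_le_on_spt[OF bm\<mu> that] by (simp add: b\<^sub>\<mu>_def f\<^sub>\<mu>_def)
    have k\<nu>b: "k\<^sub>\<nu> y' y \<le> b\<^sub>\<nu>" if "y' \<in> spt d X \<nu>" "y \<in> X" for y' y
      using S2.kernel_le_on_spt[OF bm\<nu> that(2,1)] by (simp add: b\<^sub>\<nu>_def f\<^sub>\<nu>_def)
    have "X \<noteq> {}" using diam by (auto simp: ediam_def)
    then obtain x0 where x0: "x0 \<in> X" by auto
    have rN: "0 < 1 / sqrt N" using N by simp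
    obtain Y where Y: "finite Y" "Y \<subseteq> X" "real (card Y) \<le> (2 * exp 1 * (2 + ediam d X / (1 / sqrt N))) ^ d"
      "\<And>x. x \<in> X \<Longrightarrow> \<exists>p\<in>Y. edist d x p \<le> 1 / sqrt N"
      using finite_net[OF x0 edist_le_ediam[OF K1.compact] rN d] by metis
    \<comment> \<open>The deviation \<open>s\<close> is chosen so that Hoeffding's exponent \<open>2 N s\<^sup>2 / B\<^sup>2\<close> is \<open>12 d l A\<close>.\<close>
    define q where "q = sqrt (2 * real d) * sqrt (l / N) * sqrt A"
    define s where "s = B * (sqrt 3 * q)"
    define R where "R = M * (f\<^sub>\<mu> * f\<^sub>\<nu>) * (sqrt (2 * real d) / \<epsilon> powr (1 + D\<^sub>\<mu> + D\<^sub>\<nu>)) * sqrt (l / N) * sqrt A"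
    have l1: "1 \<le> l" using N exp_le by (simp add: l_def ln_ge_iff)
    have A1: "1 \<le> A"
    proof -
      have "1 * 1 * 1 \<le> sqrt 2 * ediam d X * (1 / \<tau>)"
        using diam \<tau> by (intro mult_mono) auto
      then have "exp 1 \<le> 4 * sqrt 2 * ediam d X / \<tau>" using exp_le by simp
      then show ?thesis using diam \<tau> by (simp add: A_def ln_ge_iff)
    qed
    have q2: "q\<^sup>2 = 2 * d * (l / N) * A" using l1 A1 by (simp add: q_def power_mult_distrib)
    have q0: "0 \<le> q" using l1 A1 by (simp add: q_def)
    \<comment> \<open>This bounds the mesh, so that both error terms are multiples of \<open>q\<close>.\<close>
    have qN: "1 / sqrt N \<le> q"
    proof -
      have lA: "1 * 1 \<le> l * A" using l1 A1 by (intro mult_mono) auto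
      have "1 * (1 * 1) \<le> (2 * real d) * (l * A)" by (rule mult_mono) (use lA d in auto)
      then have "(1 / sqrt N)\<^sup>2 \<le> q\<^sup>2"
        using N by (simp add: q2 power_divide divide_right_mono)
      then show ?thesis using q0 by (rule power2_le_imp_le)
    qed
    have "ediam d X / (1 / sqrt N) = ediam d X * sqrt N" by simp
    then have tail: "2 * real (card Y) ^ 2 * exp (- 2 * real N * s\<^sup>2 / B\<^sup>2) \<le> \<tau>"
      using entropy_beaten_by_exponent[OF d N diam \<tau>, of "real (card Y)"] Y(3) B N
      by (simp add: s_def power_mult_distrib q2 l_def A_def mult_ac)
    have bound: "s + 4 * (B * (2 * L / \<epsilon>)) * (1 / sqrt N) \<le> R"
    proof -
      \<comment> \<open>The factor \<open>1 / \<epsilon>\<close> of the Lipschitz term is also given to \<open>s\<close>, as \<open>\<epsilon> \<le> 1\<close>.\<close>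
      have "sqrt 3 \<le> 2" by (rule real_le_lsqrt) auto
      also have "2 \<le> 2 / \<epsilon>" using \<epsilon> by (simp add: le_divide_eq)
      finally have "sqrt 3 \<le> 2 / \<epsilon>" .
      then have "s \<le> B * ((2 / \<epsilon>) * q)"
        unfolding s_def using B q0 by (intro mult_left_mono mult_right_mono) auto
      moreover have "4 * (B * (2 * L / \<epsilon>)) * (1 / sqrt N) \<le> 4 * (B * (2 * L / \<epsilon>)) * q"
        using qN B L \<epsilon> by (intro mult_left_mono) auto
      ultimately have "s + 4 * (B * (2 * L / \<epsilon>)) * (1 / sqrt N) \<le> B * ((2 / \<epsilon>) * q) + 4 * (B * (2 * L / \<epsilon>)) * q"
        by linarith
      also have "\<dots> = B * ((2 + 8 * L) / \<epsilon>) * q" using \<epsilon> by (simp add: field_simps)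
      also have "\<dots> = R"
        using C L \<epsilon> by (simp add: R_def M_def B_def b\<^sub>\<mu>_def b\<^sub>\<nu>_def q_def powr_add mult_ac)
      finally show ?thesis .
    qed
    have R0: "0 \<le> R" unfolding R_def using M f l1 A1 by simp
    have dev: "1 - \<tau> \<le> measure P {z \<in> space P. \<forall>x\<in>X. \<forall>y\<in>X. \<bar>?tN z x y - ?t x y\<bar> \<le> R}"
    proof -
      have "1 - \<tau> \<le> 1 - 2 * real (card Y) ^ 2 * exp (- 2 * real N * s\<^sup>2 / B\<^sup>2)" using tail by simp
      also have "\<dots> \<le> measure P {z \<in> space P. \<forall>x\<in>X. \<forall>y\<in>X. \<bar>?tN z x y - ?t x y\<bar> \<le> R}"
        unfolding P_def B_def
        by (rule uniform_deviation[OF \<pi> _ d b k\<mu>b k\<nu>b Y(1,2,4)])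
           (use N B q0 bound in \<open>auto simp: s_def B_def\<close>)
      finally show ?thesis .
    qed
    have \<pi>p: "prob_space \<pi>" "sets \<pi> = sets W" using \<pi> by (auto simp: coupling_def)
    have sp: "space \<pi> = X \<times> X" using sets_eq_imp_space_eq[OF \<pi>p(2)] space_W by simp
    have hs: "hs_norm \<mu> \<nu> (op_diff (kernel_op \<mu> (?tN z)) (kernel_op \<mu> ?t)) \<le> sup_norm X (\<lambda>x y. ?tN z x y - ?t x y)"
      if "z \<in> space P" for z
    proof -
      have z: "\<And>i. i < N \<Longrightarrow> z i \<in> X \<times> X" using that sp by (auto simp: P_def space_PiM PiE_iff)
      have "0 < N" using N by simp
      from empirical_prob_space[OF z this] \<pi>p show ?thesis by (intro hs_norm_transfer_diff_le_sup_norm)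
    qed
    have sup: "sup_norm X (\<lambda>x y. ?tN z x y - ?t x y) \<le> ennreal R \<longleftrightarrow> (\<forall>x\<in>X. \<forall>y\<in>X. \<bar>?tN z x y - ?t x y\<bar> \<le> R)" for z
      using R0 by (auto simp: sup_norm_def SUP_le_iff ennreal_le_iff)
    have "{z \<in> space P. hs_norm \<mu> \<nu> (op_diff (kernel_op \<mu> (?tN z)) (kernel_op \<mu> ?t)) \<le> sup_norm X (\<lambda>x y. ?tN z x y - ?t x y) \<and>
          sup_norm X (\<lambda>x y. ?tN z x y - ?t x y) \<le> ennreal R}
        = {z \<in> space P. \<forall>x\<in>X. \<forall>y\<in>X. \<bar>?tN z x y - ?t x y\<bar> \<le> R}"
      using hs sup by blast
    with dev have "1 - \<tau> \<le> measure P {z \<in> space P.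
          hs_norm \<mu> \<nu> (op_diff (kernel_op \<mu> (?tN z)) (kernel_op \<mu> ?t)) \<le> sup_norm X (\<lambda>x y. ?tN z x y - ?t x y) \<and>
          sup_norm X (\<lambda>x y. ?tN z x y - ?t x y) \<le> ennreal R}"
      by simp
    then show "(let t = transfer_kernel k\<^sub>\<mu> k\<^sub>\<nu> \<pi>;
           t\<^sub>N = (\<lambda>z. transfer_kernel k\<^sub>\<mu> k\<^sub>\<nu> (empirical X N z));
           P = PiM {..<N} (\<lambda>_. \<pi>)
       in measure P {z \<in> space P.
            hs_norm \<mu> \<nu> (op_diff (kernel_op \<mu> (t\<^sub>N z)) (kernel_op \<mu> t))
              \<le> sup_norm X (\<lambda>x y. t\<^sub>N z x y - t x y) \<and>
            sup_norm X (\<lambda>x y. t\<^sub>N z x y - t x y)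
              \<le> ennreal (M
                  * (scale_factor D\<^sub>\<mu> \<delta>\<^sub>\<mu> \<epsilon> * scale_factor D\<^sub>\<nu> \<delta>\<^sub>\<nu> \<epsilon>)
                  * (sqrt (2 * real d) / \<epsilon> powr (1 + D\<^sub>\<mu> + D\<^sub>\<nu>))
                  * sqrt (ln (real N) / real N)
                  * sqrt (ln (4 * sqrt 2 * ediam d X / \<tau>)))}
          \<ge> 1 - \<tau>)"
      unfolding Let_def R_def P_def f\<^sub>\<mu>_def f\<^sub>\<nu>_def l_def A_def .
  qed
qed

end
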